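(* For every positive integer $\ell$, there exist quadratic power series $\alpha\in K^{(2)}$ whose quadratic Lagrange spectrum $\mathrm{Sp}(\alpha)$ has exactly $\ell$ gaps.
   Context: Let $q$ be a positive power of a prime, $R=\mathbb F_q[Y]$, $K=\mathbb F_q(Y)$, $\widehat K=\mathbb F_q((Y^{-1}))$ with absolute value $|P/Q|=q^{\deg P-\deg Q}$ extended to $\widehat K$. Let $K^{(2)}=\{f\in\widehat K:[K(f):K]=2\}$; for $\alpha\in K^{(2)}$, $\alpha^\sigma$ is its Galois conjugate over $K$, and $\Theta_\alpha=\mathrm{PGL}_2(R)\cdot\{\alpha,\alpha^\sigma\}$. For $f\in\widehat K\setminus(K\cup\Theta_\alpha)$, $c_\alpha(f)=\liminf_{\beta\in\Theta_\alpha,\ |\beta-\beta^\sigma|\to0}\frac{|f-\beta|}{|\beta-\beta^\sigma|}$, and $\mathrm{Sp}(\alpha)=\{c_\alpha(f): f\in\widehat K\setminus(K\cup\Theta_\alpha)\}$. It is known that $\mathrm{Sp}(\alpha)\subset\{0\}\cup\{q^{-n}:n\in\mathbb Z,\ n\ge2\}$, that $\mathrm{Sp}(\alpha)$ has a maximum $\mathrm{Hw}(\alpha)=q^{-n_0}$, and that $q^{-n}\in\mathrm{Sp}(\alpha)$ for all sufficiently large $n$ (Hall's ray). A gap of $\mathrm{Sp}(\alpha)$ is a maximal nonempty set of consecutive integers $n>n_0$ such that $q^{-n}\notin\mathrm{Sp}(\alpha)$ for each $n$ in the set; $\mathrm{Sp}(\alpha)$ coincides with its Hall ray exactly when it has no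 gap. *)

theory Defs
  imports "HOL-Computational_Algebra.Computational_Algebra"
          "HOL-Library.Extended_Real" "HOL-Library.Liminf_Limsup" "HOL-Library.Cardinality"
begin

text \<open>The finite field F_q is a type 'a of class {field, finite}, q = CARD('a).
  The completion F_q((Y^{-1})) is modelled by Laurent series 'a fls in the variable
  X = Y^{-1}; thus Y corresponds to fls_X_inv.\<close>

definition Rset :: "'a::field fls set" where
  "Rset = {poly (map_poly fls_const P) fls_X_inv | P. True}"

definition Kset :: "'a::field fls set" where
  "Kset = {a / b | a b. a \<in> Rset \<and> b \<in> Rset \<and> b \<noteq> 0}"

text \<open>|f| = q^(degree in Y) = q^(- subdegree in X), |0| = 0.\<close>
definition absv :: "'a::{field,finite} fls \<Rightarrow> real" where
  "absv f = (if f = 0 then 0 else real CARD('a) powr (- real_of_int (fls_subdegree f)))"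

definition K2 :: "'a::field fls set" where
  "K2 = {f. f \<notin> Kset \<and> (\<exists>A B C. A \<in> Kset \<and> B \<in> Kset \<and> C \<in> Kset \<and>
              (A, B, C) \<noteq> (0, 0, 0) \<and> A * f ^ 2 + B * f + C = 0)}"

text \<open>Galois conjugate: the other root of the minimal polynomial A X^2 + B X + C.\<close>
definition galconj :: "'a::field fls \<Rightarrow> 'a fls" where
  "galconj f = (SOME g. \<exists>A B C. A \<in> Kset \<and> B \<in> Kset \<and> C \<in> Kset \<and> A \<noteq> 0 \<and>
              A * f ^ 2 + B * f + C = 0 \<and> g = - B / A - f)"

definition Theta :: "'a::field fls \<Rightarrow> 'a fls set" where
  "Theta \<alpha> = {(a * x + b) / (c * x + d) | a b c d x.
      a \<in> Rset \<and> b \<in> Rset \<and> c \<in> Rset \<and> d \<in> Rset \<and>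
      (\<exists>u \<in> Rset. (a * d - b * c) * u = 1) \<and> x \<in> {\<alpha>, galconj \<alpha>}}"

definition theta_filter :: "'a::{field,finite} fls \<Rightarrow> 'a fls filter" where
  "theta_filter \<alpha> = (INF e \<in> {0::real<..}.
      principal {\<beta> \<in> Theta \<alpha>. absv (\<beta> - galconj \<beta>) < e})"

definition c_alpha :: "'a::{field,finite} fls \<Rightarrow> 'a fls \<Rightarrow> ereal" where
  "c_alpha \<alpha> f = Liminf (theta_filter \<alpha>)
      (\<lambda>\<beta>. ereal (absv (f - \<beta>) / absv (\<beta> - galconj \<beta>)))"

definition Sp :: "'a::{field,finite} fls \<Rightarrow> ereal set" where
  "Sp \<alpha> = c_alpha \<alpha> ` (UNIV - (Kset \<union> Theta \<alpha>))"

text \<open>Hw(alpha) = max Sp(alpha) (the maximum exists; it equals the supremum).\<close>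
definition Hw :: "'a::{field,finite} fls \<Rightarrow> ereal" where
  "Hw \<alpha> = Sup (Sp \<alpha>)"

definition missing :: "'a::{field,finite} fls \<Rightarrow> int set" where
  "missing \<alpha> = {n. ereal (real CARD('a) powr (- real_of_int n)) < Hw \<alpha> \<and>
                    ereal (real CARD('a) powr (- real_of_int n)) \<notin> Sp \<alpha>}"

definition consecutive :: "int set \<Rightarrow> bool" where
  "consecutive G \<longleftrightarrow> (\<forall>a \<in> G. \<forall>b \<in> G. {a..b} \<subseteq> G)"

definition gaps :: "'a::{field,finite} fls \<Rightarrow> int set set" where
  "gaps \<alpha> = {G. G \<noteq> {} \<and> G \<subseteq> missing \<alpha> \<and> consecutive G \<and>
      (\<forall>G'. G \<subseteq> G' \<and> G' \<subseteq> missing \<alpha> \<and> consecutive G' \<longrightarrow> G' = G)}"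

end

(*
  Take alpha with a purely periodic continued fraction whose partial quotients are all of the form
  Y + c, with a palindromic period, so that alpha^sigma = -1/alpha.  The exponent of 1/c_alpha(f) is
  the limsup of the lengths of the overlaps, in the Bruhat-Tits tree of PGL_2, of the geodesic from
  infinity to f with the geodesics between beta and beta^sigma.  Since the partial quotients of alpha
  have degree 1, an overlap of length at least 3 passes through a vertex from which both geodesics are
  read off as bi-infinite words of partial quotients, and the overlap is the sum of two one-sided
  agreements: each agreement consists of j common letters and contributes 2j + 1, or 2j + 2 if the next
  two letters differ by a constant.  Hence an overlap of length 2k + 1 means that f contains a word of
  k letters Y + c which agrees with a factor of alpha up to a constant in one extremal letter.

  If every word of length at most l over F_q is a factor of the period of alpha, that word is itself a
  factor for k <= l, which gives an overlap of length at least 2k + 2; so the exponents 3, 5, ..., 2l + 1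
  are not attained.  The series f whose partial quotients repeat Y^2 followed by a word of length k give
  the exponent 2k + 2 if the word is a factor, and 2k + 1 if it is not, but becomes one after changing
  its last letter.  Words of the latter kind exist for each k > l if no l + 1 consecutive letters
  of the period vanish.  The gaps are then exactly {3}, {5}, ..., {2l + 1}.
*)
theory Submission
  imports Defs
begin

text \<open>Only pairs of conjugates whose distance tends to 0 count in the liminf. A pair that
  shares a word with \<open>f\<close> may agree with \<open>f\<close> far to the left of that word
  as well, and then its distance need not be small. So the period has to show each short word with
  two different left contexts, and the distance of a pair is tracked together with its overlap.
  Moebius maps of constant determinant scale partial quotients alternately by a unit
  \<open>u\<close> and its inverse. For the exponents to be excluded this is harmless, since a
  scaled pair lies in the same orbit; in the series built for the exponents to be attained all
  quotients are monic, which forces the scale 1. Quotients of degree 2 match no letter, so they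
  confine every agreement to one copy of the word. Overlaps below 3 need no description by words:
  the empty word yields overlap 2 for every \<open>f\<close>, and quotients that are all
  \<open>Y^2\<close> yield no more, so 2 is the exponent of the maximum.\<close>

unbundle fps_syntax

text \<open>Absolute values enter only through their exponents: \<open>|f| = q powr dg f\<close> for \<open>f \<noteq> 0\<close>
  (\<open>dg 0 = 0\<close> is a junk value), and \<open>ub n f\<close> says that the exponent is at most \<open>n\<close>, with \<open>0\<close> included.\<close>

definition dg :: "'a::field fls \<Rightarrow> int" where
  "dg f = - fls_subdegree f"

definition ub :: "int \<Rightarrow> 'a::field fls \<Rightarrow> bool" where
  "ub n f \<longleftrightarrow> f = 0 \<or> dg f \<le> n"

section \<open>Ultrametric calculus of exponents\<close>

lemma dg_mult: "f \<noteq> 0 \<Longrightarrow> g \<noteq> 0 \<Longrightarrow> dg (f * g) = dg f + dg g"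
  by (simp add: dg_def)

lemma dg_divide: "f \<noteq> 0 \<Longrightarrow> g \<noteq> 0 \<Longrightarrow> dg (f / g) = dg f - dg g"
  by (simp add: dg_def fls_divide_subdegree)

lemma dg_uminus [simp]: "dg (- f) = dg f"
  by (simp add: dg_def)

lemma dg_minus_commute: "dg (f - g) = dg (g - f)"
  by (simp add: dg_def fls_subdegree_minus_sym)

lemma dg_1 [simp]: "dg 1 = 0"
  by (simp add: dg_def)

lemma dg_const [simp]: "dg (fls_const c) = 0"
  by (simp add: dg_def)

lemma dg_Y [simp]: "dg fls_X_inv = 1"
  by (simp add: dg_def)

lemma dg_power: "dg (f ^ n) = int n * dg f"
  by (simp add: dg_def fls_subdegree_pow)

lemma ub_0 [simp]: "ub n 0"
  by (simp add: ub_def)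

lemma ub_nth: "ub n f \<longleftrightarrow> (\<forall>k < - n. f $$ k = 0)"
proof
  assume "ub n f"
  then show "\<forall>k < - n. f $$ k = 0"
    by (auto simp: ub_def dg_def)
next
  assume "\<forall>k < - n. f $$ k = 0"
  then show "ub n f"
    using fls_subdegree_geI[of f "- n"] by (cases "f = 0") (auto simp: ub_def dg_def)
qed

lemma ub_mono: "ub m f \<Longrightarrow> m \<le> n \<Longrightarrow> ub n f"
  by (auto simp: ub_def)

lemma ub_add: "ub n f \<Longrightarrow> ub n g \<Longrightarrow> ub n (f + g)"
  by (simp add: ub_nth)

lemma ub_diff: "ub n f \<Longrightarrow> ub n g \<Longrightarrow> ub n (f - g)"
  by (simp add: ub_nth)

lemma ub_uminus [simp]: "ub n (- f) = ub n f"
  by (simp add: ub_nth)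

lemma ub_minus_commute: "ub n (f - g) = ub n (g - f)"
  by (metis minus_diff_eq ub_uminus)

lemma ub_mult: "ub m f \<Longrightarrow> ub n g \<Longrightarrow> ub (m + n) (f * g)"
  by (cases "f = 0 \<or> g = 0") (auto simp: ub_def dg_mult)

lemma ub_divide_iff: "g \<noteq> 0 \<Longrightarrow> ub n (f / g) \<longleftrightarrow> ub (n + dg g) f"
  by (cases "f = 0") (auto simp: ub_def dg_divide)

lemma ub_dg [simp]: "ub (dg f) f"
  by (simp add: ub_def)

lemma ub_dgD: "ub n f \<Longrightarrow> f \<noteq> 0 \<Longrightarrow> dg f \<le> n"
  by (simp add: ub_def)

lemma not_ub: "\<not> ub n f \<longleftrightarrow> f \<noteq> 0 \<and> n < dg f"
  by (auto simp: ub_def)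

lemma dg_add_dominant:
  assumes "f \<noteq> 0" "ub (dg f - 1) g"
  shows "f + g \<noteq> 0" "dg (f + g) = dg f"
proof -
  have g: "g $$ k = 0" if "k \<le> fls_subdegree f" for k
    using assms(2) that by (auto simp: ub_nth dg_def)
  then have n: "(f + g) $$ fls_subdegree f \<noteq> 0"
    using assms(1) by simp
  then show "f + g \<noteq> 0"
    by (metis fls_zero_nth)
  have "fls_subdegree (f + g) = fls_subdegree f"
    by (rule fls_subdegree_eqI[OF n]) (simp add: g)
  then show "dg (f + g) = dg f"
    by (simp add: dg_def)
qed

lemma dg_close:
  assumes "f \<noteq> 0" "ub (dg f - 1) (g - f)"
  shows "g \<noteq> 0" "dg g = dg f"
  using dg_add_dominant[OF assms] by auto

lemma dg_add_less:
  assumes "f \<noteq> 0" "g = 0 \<or> dg g < dg f"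
  shows "f + g \<noteq> 0" "dg (f + g) = dg f" "f - g \<noteq> 0" "dg (f - g) = dg f"
    "g + f \<noteq> 0" "dg (g + f) = dg f" "g - f \<noteq> 0" "dg (g - f) = dg f"
proof -
  have u: "ub (dg f - 1) g" "ub (dg f - 1) (- g)"
    using assms(2) by (auto simp: ub_def)
  show 1: "f + g \<noteq> 0" "dg (f + g) = dg f" "f - g \<noteq> 0" "dg (f - g) = dg f"
    using dg_add_dominant[OF assms(1) u(1)] dg_add_dominant[OF assms(1) u(2)] by auto
  show "g + f \<noteq> 0" "dg (g + f) = dg f" "g - f \<noteq> 0" "dg (g - f) = dg f"
    using 1 by (auto simp: add.commute dg_minus_commute[of g f])
qed

lemma ub_lead:
  assumes "ub 0 f"
  obtains k where "ub (-1) (f - fls_const k)"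
proof
  show "ub (-1) (f - fls_const (f $$ 0))"
    using assms by (auto simp: ub_nth)
qed

section \<open>Polynomials and rational functions as Laurent series in \<open>1 / Y\<close>\<close>

lemma Rset_iff: "f \<in> Rset \<longleftrightarrow> (\<forall>i>0. f $$ i = 0)"
proof
  assume "f \<in> Rset"
  then obtain P where P: "f = poly (map_poly fls_const P) fls_X_inv"
    by (auto simp: Rset_def)
  show "\<forall>i>0. f $$ i = 0"
    unfolding P poly_altdef by (auto simp: fls_nth_sum coeff_map_poly intro!: sum.neutral)
next
  assume f: "\<forall>i>0. f $$ i = 0"
  define n where "n = nat (dg f)"
  define P where "P = (\<Sum>k \<le> n. monom (f $$ (- int k)) k)"
  have coeff: "coeff P i = (if i \<le> n then f $$ (- int i) else 0)" for i
    by (simp add: P_def coeff_sum)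
  have nth: "poly (map_poly fls_const P) fls_X_inv $$ j = (\<Sum>i\<le>degree P. coeff P i * (if j = - int i then 1 else 0))" for j
    unfolding poly_altdef
    by (simp add: fls_nth_sum coeff_map_poly degree_map_poly)
  have "f = poly (map_poly fls_const P) fls_X_inv"
  proof (rule fls_eqI)
    fix j
    have "(\<Sum>i\<le>degree P. coeff P i * (if j = - int i then 1 else 0)) = f $$ j"
    proof (cases "j > 0")
      case True
      then show ?thesis using f by (auto intro!: sum.neutral)
    next
      case False
      then have j: "j = - int (nat (- j))" by simp
      have "(\<Sum>i\<le>degree P. coeff P i * (if j = - int i then 1 else 0)) =
          (\<Sum>i\<le>degree P. if i = nat (- j) then coeff P i else 0)"
        using False by (intro sum.cong) auto
      also have "\<dots> = coeff P (nat (- j))"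
        by (simp add: coeff_eq_0)
      also have "\<dots> = f $$ j"
      proof (cases "nat (- j) \<le> n")
        case True
        then show ?thesis using j by (simp add: coeff)
      next
        case False
        then have "j < fls_subdegree f"
          unfolding n_def dg_def by linarith
        then show ?thesis using False by (simp add: coeff)
      qed
      finally show ?thesis .
    qed
    then show "f $$ j = poly (map_poly fls_const P) fls_X_inv $$ j"
      by (simp add: nth)
  qed
  then show "f \<in> Rset"
    by (auto simp: Rset_def)
qed

lemma Rset_add [intro]: "f \<in> Rset \<Longrightarrow> g \<in> Rset \<Longrightarrow> f + g \<in> Rset"
  and Rset_diff [intro]: "f \<in> Rset \<Longrightarrow> g \<in> Rset \<Longrightarrow> f - g \<in> Rset"
  and Rset_uminus [intro]: "f \<in> Rset \<Longrightarrow> - f \<in> Rset"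
  and Rset_const [intro, simp]: "fls_const c \<in> Rset"
  and Rset_0 [intro, simp]: "0 \<in> Rset"
  and Rset_1 [intro, simp]: "1 \<in> Rset"
  and Rset_Y [intro, simp]: "fls_X_inv \<in> Rset"
  by (auto simp: Rset_iff)

lemma Rset_mult [intro]: "f \<in> Rset \<Longrightarrow> g \<in> Rset \<Longrightarrow> f * g \<in> Rset"
  unfolding Rset_iff
proof (intro allI impI)
  fix n :: int
  assume fg: "\<forall>i>0. f $$ i = 0" "\<forall>i>0. g $$ i = 0" and n: "n > 0"
  have "f $$ i * g $$ (n - i) = 0" for i
    using fg n by (cases "i > 0") auto
  then show "(f * g) $$ n = 0"
    unfolding fls_times_nth(2) by (intro sum.neutral) blast
qed

lemma Rset_power [intro]: "f \<in> Rset \<Longrightarrow> f ^ n \<in> Rset"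
  by (induction n) auto

text \<open>Discreteness of the polynomials; it makes integral parts, and hence continued fractions,
  unique.\<close>

lemma Rset_ub_neg: "f \<in> Rset \<Longrightarrow> ub (-1) f \<Longrightarrow> f = 0"
  by (force simp: Rset_iff ub_nth intro!: fls_eqI)

lemma Rset_dg_nonneg: "f \<in> Rset \<Longrightarrow> f \<noteq> 0 \<Longrightarrow> 0 \<le> dg f"
  using Rset_ub_neg[of f] by (force simp: ub_def)

lemma Rset_eqI: "f \<in> Rset \<Longrightarrow> g \<in> Rset \<Longrightarrow> ub (-1) (f - g) \<Longrightarrow> f = g"
  using Rset_ub_neg[of "f - g"] by auto

lemma Rset_ub_0: 
  assumes "f \<in> Rset" "ub 0 f"
  obtains k where "f = fls_const k"
proof -
  obtain k where "ub (-1) (f - fls_const k)"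
    using ub_lead assms(2) .
  then have "f = fls_const k"
    using assms(1) by (intro Rset_eqI) auto
  then show ?thesis by (rule that)
qed

text \<open>Degrees add up and are nonnegative, so both factors have degree 0. This turns the
  invertible determinants in \<open>Theta\<close> into nonzero constants.\<close>

lemma Rset_unit:
  assumes "f \<in> Rset" "g \<in> Rset" "f * g = 1"
  obtains k where "k \<noteq> 0" "f = fls_const k"
proof -
  have nz: "f \<noteq> 0" "g \<noteq> 0"
    using assms(3) by auto
  then have "dg f + dg g = 0"
    using dg_mult[of f g] assms(3) by simp
  then have "ub 0 f"
    using Rset_dg_nonneg nz assms by (force simp: ub_def)
  then obtain k where "f = fls_const k"
    using Rset_ub_0 assms(1) by blast
  then show ?thesis
    using nz that[of k] by auto
qed

lemma fls_const_inverse: "inverse (fls_const (k::'a::field)) = fls_const (inverse k)"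
proof (cases "k = 0")
  case False
  then have "fls_const k * fls_const (inverse k) = 1"
    by simp
  then show ?thesis
    by (rule inverse_unique)
qed simp

lemma floor_exists: "\<exists>a\<in>Rset. ub (-1) (f - a)"
proof -
  define a where "a = Abs_fls (\<lambda>i. if i > 0 then 0 else f $$ i)"
  have nth: "a $$ i = (if i > 0 then 0 else f $$ i)" for i
    unfolding a_def
    by (rule nth_Abs_fls_ex_lower_bound) (auto intro!: exI[of _ "fls_subdegree f"])
  show ?thesis
    by (rule bexI[of _ a]) (auto simp: Rset_iff ub_nth nth)
qed

lemma Rset_subset_Kset: "f \<in> Rset \<Longrightarrow> f \<in> Kset"
  unfolding Kset_def by (rule CollectI, rule exI[of _ f], rule exI[of _ 1]) auto

lemma Kset_add [intro]: "f \<in> Kset \<Longrightarrow> g \<in> Kset \<Longrightarrow> f + g \<in> Kset"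
proof -
  assume "f \<in> Kset" "g \<in> Kset"
  then obtain a b c d where *: "f = a / b" "g = c / d" "a \<in> Rset" "b \<in> Rset" "c \<in> Rset" "d \<in> Rset" "b \<noteq> 0" "d \<noteq> 0"
    unfolding Kset_def by auto
  then have "f + g = (a * d + c * b) / (b * d)"
    by (simp add: field_simps)
  then show ?thesis
    unfolding Kset_def using * by (intro CollectI exI[of _ "a * d + c * b"] exI[of _ "b * d"]) auto
qed

lemma Kset_mult [intro]: "f \<in> Kset \<Longrightarrow> g \<in> Kset \<Longrightarrow> f * g \<in> Kset"
proof -
  assume "f \<in> Kset" "g \<in> Kset"
  then obtain a b c d where *: "f = a / b" "g = c / d" "a \<in> Rset" "b \<in> Rset" "c \<in> Rset" "d \<in> Rset" "b \<noteq> 0" "d \<noteq> 0"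
    unfolding Kset_def by auto
  then have "f * g = (a * c) / (b * d)"
    by (simp add: field_simps)
  then show ?thesis
    unfolding Kset_def using * by (intro CollectI exI[of _ "a * c"] exI[of _ "b * d"]) auto
qed

lemma Kset_inverse [intro]: "f \<in> Kset \<Longrightarrow> inverse f \<in> Kset"
proof (cases "f = 0")
  case True
  then show ?thesis using Rset_subset_Kset[OF Rset_0] by simp
next
  case False
  assume "f \<in> Kset"
  then obtain a b where *: "f = a / b" "a \<in> Rset" "b \<in> Rset" "b \<noteq> 0"
    unfolding Kset_def by auto
  then have "inverse f = b / a" "a \<noteq> 0"
    using False by (auto simp: field_simps)
  then show ?thesis
    unfolding Kset_def using * by auto
qed

lemma Kset_uminus [intro]: "f \<in> Kset \<Longrightarrow> - f \<in> Kset"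
  using Kset_mult[of "- 1" f] Rset_subset_Kset[OF Rset_uminus[OF Rset_1]] by simp

lemma Kset_diff [intro]: "f \<in> Kset \<Longrightarrow> g \<in> Kset \<Longrightarrow> f - g \<in> Kset"
  using Kset_add[of f "- g"] by (auto simp del: Kset_add)

lemma Kset_divide [intro]: "f \<in> Kset \<Longrightarrow> g \<in> Kset \<Longrightarrow> f / g \<in> Kset"
  by (auto simp: divide_inverse)

lemma Kset_0 [simp]: "0 \<in> Kset" and Kset_1 [simp]: "1 \<in> Kset"
  by (auto intro: Rset_subset_Kset)

lemma fls_eq_0_if_ub:
  assumes "\<And>n::nat. ub (- int n) f"
  shows "f = 0"
proof (rule ccontr)
  assume "f \<noteq> 0"
  then show False
    using assms[of "nat (1 - dg f)"] by (auto simp: ub_def split: if_splits)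
qed

section \<open>Quadratic irrationals and their conjugates\<close>

lemma lin_nonzero:
  assumes "z \<notin> Kset" "c \<in> Kset" "d \<in> Kset" "c \<noteq> 0 \<or> d \<noteq> 0"
  shows "c * z + d \<noteq> 0"
proof
  assume *: "c * z + d = 0"
  then have "c \<noteq> 0"
    using assms(4) by auto
  then have "z = - d / c"
    using * by (simp add: field_simps add_eq_0_iff)
  then show False
    using assms by auto
qed

text \<open>Subtracting \<open>A\<close> times \<open>(X - x) * (X - y)\<close> from a quadratic
  relation for \<open>x\<close> leaves a linear relation over \<open>Kset\<close>, which must vanish
  because \<open>x\<close> is irrational. Hence the choice in \<open>galconj\<close> has a single
  candidate.\<close>

lemma galconj_eqI:
  assumes "x \<notin> Kset" "x + y \<in> Kset" "x * y \<in> Kset"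
  shows "galconj x = y"
  unfolding galconj_def
proof (rule some_equality)
  show "\<exists>A B C. A \<in> Kset \<and> B \<in> Kset \<and> C \<in> Kset \<and> A \<noteq> 0 \<and>
      A * x\<^sup>2 + B * x + C = 0 \<and> y = - B / A - x"
  proof (intro exI conjI)
    show "1 * x\<^sup>2 + - (x + y) * x + x * y = 0" "y = - (- (x + y)) / 1 - x"
      by (simp_all add: algebra_simps power2_eq_square)
    show "- (x + y) \<in> Kset"
      using assms by blast
  qed (use assms in simp_all)
next
  fix g
  assume "\<exists>A B C. A \<in> Kset \<and> B \<in> Kset \<and> C \<in> Kset \<and> A \<noteq> 0 \<and>
      A * x\<^sup>2 + B * x + C = 0 \<and> g = - B / A - x"
  then obtain A B C where *: "A \<in> Kset" "B \<in> Kset" "C \<in> Kset" "A \<noteq> 0"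
    "A * x\<^sup>2 + B * x + C = 0" "g = - B / A - x"
    by blast
  have "A * x\<^sup>2 + B * x + C - A * (x\<^sup>2 - (x + y) * x + x * y) = (B + A * (x + y)) * x + (C - A * (x * y))"
    by (simp add: algebra_simps)
  moreover have "x\<^sup>2 - (x + y) * x + x * y = 0"
    by (simp add: algebra_simps power2_eq_square)
  ultimately have "(B + A * (x + y)) * x + (C - A * (x * y)) = 0"
    using *(5) by simp
  then have "B + A * (x + y) = 0"
    using lin_nonzero[OF assms(1), of "B + A * (x + y)" "C - A * (x * y)"] * assms by blast
  then have "y = - B / A - x"
    using *(4) by (simp add: field_simps add_eq_0_iff)
  then show "g = y"
    using * by simp
qed

lemma K2_I:
  assumes "x \<notin> Kset" "x + y \<in> Kset" "x * y \<in> Kset"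
  shows "x \<in> K2"
  unfolding K2_def
proof (intro CollectI conjI exI)
  show "1 * x\<^sup>2 + - (x + y) * x + x * y = 0"
    by (simp add: algebra_simps power2_eq_square)
  show "- (x + y) \<in> Kset"
    using assms by blast
qed (use assms in simp_all)

section \<open>Continued fractions\<close>

lemma dg_cf_denominator:
  assumes "1 \<le> dg a" "ub (-1) u"
  shows "a + u \<noteq> 0" "dg (a + u) = dg a"
proof -
  have "a \<noteq> 0" "ub (dg a - 1) u"
    using assms by (auto simp: dg_def intro: ub_mono)
  then show "a + u \<noteq> 0" "dg (a + u) = dg a"
    using dg_add_dominant by auto
qed

lemma dg_cf:
  assumes "1 \<le> dg a" "ub (-1) u"
  shows "dg (1 / (a + u)) = - dg a" "1 / (a + u) \<noteq> 0" "ub (-1) (1 / (a + u))"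
  using dg_cf_denominator[OF assms] assms(1) by (auto simp: dg_divide ub_def)

text \<open>Both denominators have exponent \<open>dg a\<close>, so one step of the expansion
  contracts distances by exactly \<open>2 * dg a\<close>. The equivalence is what makes agreement
  lengths exact later on.\<close>

lemma ub_cf_diff:
  assumes "1 \<le> dg a" "ub (-1) u" "ub (-1) v"
  shows "ub (n - 2 * dg a) (1 / (a + u) - 1 / (a + v)) \<longleftrightarrow> ub n (u - v)"
proof -
  note nz = dg_cf_denominator[OF assms(1,2)] dg_cf_denominator[OF assms(1,3)]
  have "1 / (a + u) - 1 / (a + v) = (v - u) / ((a + u) * (a + v))"
    using nz by (simp add: field_simps)
  then show ?thesis
    using nz by (simp add: ub_divide_iff dg_mult ub_minus_commute[of n v u])
qed

text \<open>The truncations \<open>y m\<close> form a Cauchy sequence since each step contracts. The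
  index type is left open because both one-sided expansions (\<open>Suc\<close> on
  \<open>nat\<close>) and two-sided ones (the shift on \<open>int\<close>) are needed.\<close>

lemma cf_exists:
  fixes a :: "'i \<Rightarrow> 'a::field fls" and \<sigma> :: "'i \<Rightarrow> 'i"
  assumes a: "\<And>i. 1 \<le> dg (a i)"
  shows "\<exists>x. \<forall>i. ub (-1) (x i) \<and> x i = 1 / (a i + x (\<sigma> i))"
proof -
  define y where "y = rec_nat (\<lambda>i. 0) (\<lambda>m f i. 1 / (a i + f (\<sigma> i)))"
  have y0: "y 0 i = 0" and ySuc: "y (Suc m) i = 1 / (a i + y m (\<sigma> i))" for m i
    by (simp_all add: y_def)
  have small: "ub (-1) (y m i)" for m i
    by (induction m arbitrary: i) (auto simp: y0 ySuc dg_cf a)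
  have step: "ub (- int m - 1) (y (Suc m) i - y m i)" for m i
  proof (induction m arbitrary: i)
    case 0
    show ?case using small[of 1 i] by (simp add: y0)
  next
    case (Suc m)
    then have "ub (- int m - 1 - 2 * dg (a i)) (y (Suc (Suc m)) i - y (Suc m) i)"
      unfolding ySuc[of "Suc m"] ySuc[of m i] using ub_cf_diff[OF a small small] by blast
    then show ?case
      by (rule ub_mono) (use a[of i] in simp)
  qed
  have tele: "ub (- int m - 1) (y (m + k) i - y m i)" for m k i
  proof (induction k)
    case (Suc k)
    have "ub (- int m - 1) (y (Suc (m + k)) i - y (m + k) i)"
      using step by (rule ub_mono) simp
    from ub_add[OF this Suc] show ?case by simp
  qed simp
  \<comment> \<open>By \<open>tele\<close>, coefficient \<open>k\<close> no longer changes from the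
    truncation \<open>y (nat k)\<close> on.\<close>
  define z where "z i = Abs_fls (\<lambda>k. if k < 1 then 0 else y (nat k) i $$ k)" for i
  have nth: "z i $$ k = (if k < 1 then 0 else y (nat k) i $$ k)" for i k
    unfolding z_def by (rule nth_Abs_fls_ex_lower_bound) (auto intro!: exI[of _ 0])
  have approx: "ub (- int m - 1) (z i - y m i)" for m i
    unfolding ub_nth
  proof (intro allI impI)
    fix k
    assume k: "k < - (- int m - 1)"
    show "(z i - y m i) $$ k = 0"
    proof (cases "k < 1")
      case True
      then show ?thesis using small[of m i] by (simp add: nth ub_nth)
    next
      case False
      then have "ub (- k - 1) (y m i - y (nat k) i)"
        using tele[of "nat k" "m - nat k" i] k by simp
      then show ?thesis
        using False by (simp add: nth ub_nth)
    qed
  qed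
  have zs: "ub (-1) (z i)" for i
    using approx[of 0 i] by (simp add: y0)
  have "z i = 1 / (a i + z (\<sigma> i))" for i
  proof -
    have "ub (- int m) (z i - 1 / (a i + z (\<sigma> i)))" for m
    proof -
      have "ub (- int m) (z i - y (Suc m) i)"
        using approx[of "Suc m" i] by (rule ub_mono) simp
      moreover have "ub (- int m - 1 - 2 * dg (a i)) (y (Suc m) i - 1 / (a i + z (\<sigma> i)))"
        unfolding ySuc ub_cf_diff[OF a small zs] using approx ub_minus_commute by blast
      then have "ub (- int m) (y (Suc m) i - 1 / (a i + z (\<sigma> i)))"
        by (rule ub_mono) (use a[of i] in simp)
      ultimately show ?thesis
        using ub_add by fastforce
    qed
    then show ?thesis
      using fls_eq_0_if_ub by fastforce
  qed
  then show ?thesis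
    using zs by blast
qed

lemma cf_unique:
  fixes a :: "'i \<Rightarrow> 'a::field fls" and \<sigma> :: "'i \<Rightarrow> 'i"
  assumes a: "\<And>i. 1 \<le> dg (a i)"
    and x: "\<And>i. ub (-1) (x i)" "\<And>i. x i = 1 / (a i + x (\<sigma> i))"
    and y: "\<And>i. ub (-1) (y i)" "\<And>i. y i = 1 / (a i + y (\<sigma> i))"
  shows "x i = y i"
proof -
  have "ub (- int n) (x i - y i)" for n i
  proof (induction n arbitrary: i)
    case 0
    show ?case using ub_diff[OF x(1) y(1), of i i] by (rule ub_mono) simp
  next
    case (Suc n)
    have "ub (- int n - 2 * dg (a i)) (x i - y i)"
      using ub_cf_diff[OF a x(1) y(1)] Suc x(2) y(2) by metis
    then show ?case
      by (rule ub_mono) (use a[of i] in simp)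
  qed
  then show ?thesis
    using fls_eq_0_if_ub by fastforce
qed

text \<open>Infinite descent, as in Euclid's algorithm: a step turns \<open>p / q\<close> into
  \<open>(q - a n * p) / p\<close>, and \<open>dg p < dg q\<close>.\<close>

lemma cf_irrational:
  fixes x a :: "nat \<Rightarrow> 'a::field fls"
  assumes a: "\<And>n. a n \<in> Rset" "\<And>n. 1 \<le> dg (a n)"
    and x: "\<And>n. ub (-1) (x n)" "\<And>n. x n = 1 / (a n + x (Suc n))"
  shows "x n \<notin> Kset"
proof
  assume "x n \<in> Kset"
  then obtain p q where pq: "x n = p / q" "p \<in> Rset" "q \<in> Rset" "q \<noteq> 0"
    by (auto simp: Kset_def)
  then show False
  proof (induction "nat (dg q)" arbitrary: n p q rule: less_induct)
    case less
    have nz: "x n \<noteq> 0" "dg (x n) \<le> - 1"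
      using dg_cf[OF a(2)[of n] x(1)[of "Suc n"]] x(2)[of n] a(2)[of n] by auto
    have p: "p \<noteq> 0"
      using nz less.prems by auto
    then have "dg p < dg q"
      using nz less.prems dg_divide[of p q] by auto
    moreover have "0 \<le> dg p"
      using p less.prems Rset_dg_nonneg by auto
    moreover have "x (Suc n) = (q - a n * p) / p"
    proof -
      have "a n + x (Suc n) = 1 / x n"
        using x(2)[of n] by simp
      then have "x (Suc n) = q / p - a n"
        using less.prems by (simp add: algebra_simps)
      then show ?thesis
        using p by (simp add: field_simps)
    qed
    ultimately show False
      using less.hyps[of p "Suc n" "q - a n * p"] p less.prems a by auto
  qed
qed

lemma mobius_comp:
  fixes z :: "'a::field"
  assumes "c' * z + d' \<noteq> 0"
  shows "(a * ((a' * z + b') / (c' * z + d')) + b) / (c * ((a' * z + b') / (c' * z + d')) + d) =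
    ((a * a' + b * c') * z + (a * b' + b * d')) / ((c * a' + d * c') * z + (c * b' + d * d'))"
proof -
  have "a * ((a' * z + b') / (c' * z + d')) + b = ((a * a' + b * c') * z + (a * b' + b * d')) / (c' * z + d')"
    "c * ((a' * z + b') / (c' * z + d')) + d = ((c * a' + d * c') * z + (c * b' + d * d')) / (c' * z + d')"
    using assms by (simp_all add: field_simps)
  then show ?thesis
    using assms by simp
qed

definition letter :: "'a::field \<Rightarrow> 'a fls" where
  "letter k = fls_X_inv + fls_const k"

lemma dg_letter [simp]: "dg (letter k) = 1"
  using dg_add_less(2)[of fls_X_inv "fls_const k"] by (simp add: letter_def)

lemma letter_Rset [intro, simp]: "letter k \<in> Rset"
  by (auto simp: letter_def)

lemma letter_nonzero [simp]: "letter k \<noteq> 0"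
  using dg_letter[of k] by (auto simp: dg_def)

section \<open>Conjugate pairs\<close>

text \<open>The complete quotients \<open>A t\<close> of a purely periodic continued fraction. Palindromicity of the
  period makes \<open>Ac 0 = - 1 / A 0\<close> the Galois conjugate of \<open>A 0\<close>, so that the orbits of the two coincide.\<close>

locale quadratic_line =
  fixes c :: "int \<Rightarrow> 'a::{field,finite}" and p :: nat and A :: "int \<Rightarrow> 'a fls"
  assumes period_pos: "p > 0"
    and period: "\<And>t. c (t + int p) = c t"
    and palindromic: "\<And>t. c (- 1 - t) = c t"
    and A_step: "\<And>t. A t = letter (c t) + 1 / A (t + 1)"
    and A_small: "\<And>t. ub (-1) (1 / A t)"
begin

lemma A_nonzero [simp]: "A t \<noteq> 0"
  and dg_A [simp]: "dg (A t) = 1"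
  using dg_cf_denominator[of "letter (c t)" "1 / A (t + 1)"] A_small[of "t + 1"] A_step[of t] by auto

definition Ac :: "int \<Rightarrow> 'a fls" where
  "Ac t = - 1 / A (- t)"

lemma Ac_nonzero [simp]: "Ac t \<noteq> 0"
  and dg_Ac [simp]: "dg (Ac t) = - 1"
  by (auto simp: Ac_def dg_divide)

text \<open>By palindromicity the recursion of \<open>A\<close> at \<open>- 1 - t\<close>, read
  backwards, is the forward recursion of \<open>Ac\<close> at \<open>t\<close>. So \<open>A\<close>
  and \<open>Ac\<close> are transported by the same matrices.\<close>

lemma Ac_step: "Ac t = letter (c t) + 1 / Ac (t + 1)"
proof -
  have "A (- (t + 1)) = letter (c t) + 1 / A (- t)"
    using A_step[of "- 1 - t"] palindromic[of t] by (simp add: algebra_simps)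
  then show ?thesis
    by (simp add: Ac_def)
qed

lemma A_irrational: "A t \<notin> Kset"
proof
  assume "A t \<in> Kset"
  have "1 / A (t + int 0) \<notin> Kset"
  proof (rule cf_irrational)
    fix n
    show "1 / A (t + int n) = 1 / (letter (c (t + int n)) + 1 / A (t + int (Suc n)))"
      using A_step[of "t + int n"] by (simp add: add.commute add.left_commute)
  qed (auto simp: A_small)
  then show False
    using \<open>A t \<in> Kset\<close> by auto
qed

lemma Ac_irrational: "Ac t \<notin> Kset"
proof
  assume "Ac t \<in> Kset"
  then have "- 1 / Ac t \<in> Kset"
    by (intro Kset_divide Kset_uminus Kset_1)
  then show False
    using A_irrational[of "- t"] by (simp add: Ac_def)
qed

lemma denominator_nonzero:
  assumes "g \<in> Rset" "d \<in> Rset" "g \<noteq> 0 \<or> d \<noteq> 0"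
  shows "g * A t + d \<noteq> 0" "g * Ac t + d \<noteq> 0"
  using assms lin_nonzero[OF A_irrational] lin_nonzero[OF Ac_irrational] Rset_subset_Kset by blast+

lemma A_period: "A (t + int p) = A t"
proof -
  have "1 / A (t + int p) = 1 / A t"
  proof (rule cf_unique[where a = "\<lambda>t. letter (c t)" and \<sigma> = "\<lambda>t. t + 1" and x = "\<lambda>t. 1 / A (t + int p)"])
    fix i
    show "1 / A i = 1 / (letter (c i) + 1 / A (i + 1))"
      using A_step[of i] by simp
    show "1 / A (i + int p) = 1 / (letter (c i) + 1 / A (i + 1 + int p))"
      using A_step[of "i + int p"] by (simp add: period ac_simps)
  qed (auto simp: A_small)
  then show ?thesis by simp
qed

text \<open>Product of the step matrices, with denominators cleared. \<open>R \<noteq> 0\<close>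
  makes the fixed point equation over one period truly quadratic; the bound on \<open>S\<close>
  carries it through the induction.\<close>

lemma transfer_matrix:
  "\<exists>P Q R S. P \<in> Rset \<and> Q \<in> Rset \<and> R \<in> Rset \<and> S \<in> Rset \<and> R \<noteq> 0 \<and> (S = 0 \<or> dg S < dg R) \<and>
     A 0 * (R * A (int (Suc m)) + S) = P * A (int (Suc m)) + Q \<and>
     Ac 0 * (R * Ac (int (Suc m)) + S) = P * Ac (int (Suc m)) + Q"
proof (induction m)
  case 0
  have "A 0 * (1 * A 1 + 0) = letter (c 0) * A 1 + 1" "Ac 0 * (1 * Ac 1 + 0) = letter (c 0) * Ac 1 + 1"
    using A_step[of 0] Ac_step[of 0] by (simp_all add: field_simps)
  then show ?case
    by (intro exI[of _ "letter (c 0)"] exI[of _ 1] exI[of _ 0]) auto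
next
  case (Suc m)
  then obtain P Q R S where *: "P \<in> Rset" "Q \<in> Rset" "R \<in> Rset" "S \<in> Rset" "R \<noteq> 0" "S = 0 \<or> dg S < dg R"
     "A 0 * (R * A (int (Suc m)) + S) = P * A (int (Suc m)) + Q"
     "Ac 0 * (R * Ac (int (Suc m)) + S) = P * Ac (int (Suc m)) + Q"
    by blast
  define b where "b = letter (c (int (Suc m)))"
  have R: "R * b \<noteq> 0" "dg (R * b) = dg R + 1"
    using * by (auto simp: b_def dg_mult)
  then have R': "R * b + S \<noteq> 0" "dg (R * b + S) = dg R + 1"
    using dg_add_less(1,2)[of "R * b" S] *(6) by auto
  have step: "x0 * ((R * b + S) * y + R) = (P * b + Q) * y + P"
    if "x0 * (R * x + S) = P * x + Q" "x = b + 1 / y" "y \<noteq> 0" for x0 x y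
  proof -
    have "x * y = b * y + 1"
      using that by (simp add: field_simps)
    have "x0 * ((R * b + S) * y + R) = x0 * (R * (b * y + 1) + S * y)"
      by (simp add: algebra_simps)
    also have "\<dots> = x0 * (R * x + S) * y"
      unfolding \<open>x * y = b * y + 1\<close>[symmetric] by (simp add: algebra_simps)
    also have "\<dots> = P * (x * y) + Q * y"
      using that by (simp add: algebra_simps)
    finally show ?thesis
      using \<open>x * y = b * y + 1\<close> by (simp add: algebra_simps)
  qed
  have "A (int (Suc m)) = b + 1 / A (int (Suc (Suc m)))" "Ac (int (Suc m)) = b + 1 / Ac (int (Suc (Suc m)))"
    using A_step[of "int (Suc m)"] Ac_step[of "int (Suc m)"] by (simp_all add: b_def ac_simps)
  then have "A 0 * ((R * b + S) * A (int (Suc (Suc m))) + R) = (P * b + Q) * A (int (Suc (Suc m))) + P"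
    "Ac 0 * ((R * b + S) * Ac (int (Suc (Suc m))) + R) = (P * b + Q) * Ac (int (Suc (Suc m))) + P"
    using step[OF *(7)] step[OF *(8)] by auto
  moreover have "P * b + Q \<in> Rset" "R * b + S \<in> Rset"
    using * by (auto simp: b_def)
  ultimately show ?case
    using * R' by (intro exI[of _ "P * b + Q"] exI[of _ P] exI[of _ "R * b + S"] exI[of _ R]) auto
qed

lemma A_neq_Ac: "A t \<noteq> Ac s"
  using dg_A[of t] dg_Ac[of s] by (metis one_neq_neg_one)

lemma Ac_period: "Ac (int p) = Ac 0"
  using A_period[of "- int p"] by (simp add: Ac_def)

lemma A_Ac_mult: "A 0 * Ac 0 = - 1"
  by (simp add: Ac_def)

text \<open>Over one period, \<open>A 0\<close> and \<open>Ac 0\<close> are distinct roots of the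
  same quadratic equation. Subtracting the two equations and cancelling the difference of the roots
  is Vieta's formula for the sum.\<close>

lemma A_Ac_sum: "A 0 + Ac 0 \<in> Kset"
proof -
  obtain P Q R S where *: "P \<in> Rset" "R \<in> Rset" "S \<in> Rset" "R \<noteq> 0"
     "A 0 * (R * A 0 + S) = P * A 0 + Q" "Ac 0 * (R * Ac 0 + S) = P * Ac 0 + Q"
    using transfer_matrix[of "p - 1"] period_pos A_period[of 0] Ac_period by auto
  have "(A 0 - Ac 0) * (R * (A 0 + Ac 0) + (S - P)) =
      (A 0 * (R * A 0 + S) - P * A 0) - (Ac 0 * (R * Ac 0 + S) - P * Ac 0)"
    by (simp add: algebra_simps)
  also have "\<dots> = 0"
    using *(5,6) by simp
  finally have "R * (A 0 + Ac 0) + (S - P) = 0"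
    using A_neq_Ac[of 0 0] by simp
  then have "A 0 + Ac 0 = (P - S) / R"
    using *(4) by (simp add: field_simps eq_diff_eq add_eq_0_iff)
  then show ?thesis
    using * Rset_subset_Kset by auto
qed

lemma galconj_A: "galconj (A 0) = Ac 0"
  by (rule galconj_eqI) (auto simp: A_irrational A_Ac_sum A_Ac_mult)

lemma A_K2: "A 0 \<in> K2"
  by (rule K2_I[where y = "Ac 0"]) (auto simp: A_irrational A_Ac_sum A_Ac_mult)

text \<open>The pairs of Galois conjugates in \<open>\<Theta>\<close>.\<close>

definition TP :: "('a fls \<times> 'a fls) set" where
  "TP = {(x, y). \<exists>a b c d k. a \<in> Rset \<and> b \<in> Rset \<and> c \<in> Rset \<and> d \<in> Rset \<and> k \<noteq> 0 \<and>
    a * d - b * c = fls_const k \<and> x = (a * A 0 + b) / (c * A 0 + d) \<and> y = (a * Ac 0 + b) / (c * Ac 0 + d)}"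

lemma TP_I:
  assumes "a \<in> Rset" "b \<in> Rset" "g \<in> Rset" "d \<in> Rset" "k \<noteq> 0" "a * d - b * g = fls_const k"
  shows "((a * A 0 + b) / (g * A 0 + d), (a * Ac 0 + b) / (g * Ac 0 + d)) \<in> TP"
  using assms unfolding TP_def by blast

lemma TP_mobius:
  assumes "(x, y) \<in> TP" "a \<in> Rset" "b \<in> Rset" "g \<in> Rset" "d \<in> Rset" "k \<noteq> 0" "a * d - b * g = fls_const k"
  shows "((a * x + b) / (g * x + d), (a * y + b) / (g * y + d)) \<in> TP"
proof -
  obtain a' b' c' d' k' where *: "a' \<in> Rset" "b' \<in> Rset" "c' \<in> Rset" "d' \<in> Rset" "k' \<noteq> 0"
    "a' * d' - b' * c' = fls_const k'" "x = (a' * A 0 + b') / (c' * A 0 + d')" "y = (a' * Ac 0 + b') / (c' * Ac 0 + d')"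
    using assms(1) unfolding TP_def by blast
  have "c' \<noteq> 0 \<or> d' \<noteq> 0"
    using *(5,6) by auto
  then have nz: "c' * A 0 + d' \<noteq> 0" "c' * Ac 0 + d' \<noteq> 0"
    using denominator_nonzero *(3,4) by blast+
  have "(a * a' + b * c') * (g * b' + d * d') - (a * b' + b * d') * (g * a' + d * c') =
     (a * d - b * g) * (a' * d' - b' * c')"
    by (simp add: algebra_simps)
  also have "\<dots> = fls_const (k * k')"
    using * assms by simp
  finally show ?thesis
    unfolding *(7,8) mobius_comp[OF nz(1)] mobius_comp[OF nz(2)]
    by (intro TP_I) (use * assms in auto)
qed

lemma TP_irrational:
  assumes "(x, y) \<in> TP"
  shows "x \<notin> Kset" "y \<notin> Kset" "x \<noteq> y" "x + y \<in> Kset" "x * y \<in> Kset"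
proof -
  obtain a b c d k where *: "a \<in> Rset" "b \<in> Rset" "c \<in> Rset" "d \<in> Rset" "k \<noteq> 0"
    "a * d - b * c = fls_const k" "x = (a * A 0 + b) / (c * A 0 + d)" "y = (a * Ac 0 + b) / (c * Ac 0 + d)"
    using assms unfolding TP_def by blast
  note K = *(1-4)[THEN Rset_subset_Kset]
  have "c \<noteq> 0 \<or> d \<noteq> 0"
    using *(5,6) by auto
  then have nz: "c * A 0 + d \<noteq> 0" "c * Ac 0 + d \<noteq> 0"
    using denominator_nonzero *(3,4) by blast+
  have irr: "z \<notin> Kset" if z: "w \<notin> Kset" "c * w + d \<noteq> 0" "z = (a * w + b) / (c * w + d)" for z w
  proof
    assume z': "z \<in> Kset"
    have eq: "(a - z * c) * w + (b - z * d) = 0"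
      using z by (simp add: field_simps)
    have "a - z * c = 0 \<and> b - z * d = 0"
      using lin_nonzero[OF z(1), of "a - z * c" "b - z * d"] eq K z' by blast
    then have "a * d - b * c = 0"
      by (auto simp: algebra_simps)
    then show False
      using * by simp
  qed
  show "x \<notin> Kset" "y \<notin> Kset"
    using irr[OF A_irrational nz(1) *(7)] irr[OF Ac_irrational nz(2) *(8)] .
  have "x - y = (a * d - b * c) * (A 0 - Ac 0) / ((c * A 0 + d) * (c * Ac 0 + d))"
    unfolding *(7,8) using nz by (simp add: divide_simps) (simp add: algebra_simps)
  then show "x \<noteq> y"
    using *(5,6) nz A_neq_Ac[of 0 0] by auto
  have prod: "(c * A 0 + d) * (c * Ac 0 + d) = d * d - c * c + c * d * (A 0 + Ac 0)" 
    using A_Ac_mult by (simp add: algebra_simps)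
  have "x + y = ((a * A 0 + b) * (c * Ac 0 + d) + (a * Ac 0 + b) * (c * A 0 + d)) / ((c * A 0 + d) * (c * Ac 0 + d))"
    unfolding *(7,8) using nz by (simp add: divide_simps)
  also have "(a * A 0 + b) * (c * Ac 0 + d) + (a * Ac 0 + b) * (c * A 0 + d) =
      2 * (a * c) * (A 0 * Ac 0) + (a * d + b * c) * (A 0 + Ac 0) + 2 * (b * d)"
    by (simp add: algebra_simps)
  finally have 1: "x + y = (- (a * c) - a * c + (a * d + b * c) * (A 0 + Ac 0) + (b * d + b * d)) / (d * d - c * c + c * d * (A 0 + Ac 0))"
    unfolding prod A_Ac_mult by (simp add: algebra_simps)
  show "x + y \<in> Kset"
    unfolding 1 using K A_Ac_sum by blast
  have "x * y = (b * b - a * a + a * b * (A 0 + Ac 0)) / (d * d - c * c + c * d * (A 0 + Ac 0))"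
    unfolding *(7,8) times_divide_times_eq prod using A_Ac_mult by (simp add: algebra_simps)
  then show "x * y \<in> Kset"
    using K A_Ac_sum by auto
qed

lemma galconj_TP: "(x, y) \<in> TP \<Longrightarrow> galconj x = y"
  using TP_irrational galconj_eqI by blast

lemma TP_add: "(x, y) \<in> TP \<Longrightarrow> a \<in> Rset \<Longrightarrow> (a + x, a + y) \<in> TP"
  using TP_mobius[of x y 1 a 0 1 1] by (simp add: add.commute)

lemma TP_diff: "(x, y) \<in> TP \<Longrightarrow> a \<in> Rset \<Longrightarrow> (x - a, y - a) \<in> TP"
  using TP_add[of x y "- a"] by (simp add: Rset_uminus)

lemma TP_inverse: "(x, y) \<in> TP \<Longrightarrow> (1 / x, 1 / y) \<in> TP"
  using TP_mobius[of x y 0 1 1 0 "- 1"] by simp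

lemma TP_scale: "(x, y) \<in> TP \<Longrightarrow> k \<noteq> 0 \<Longrightarrow> (fls_const k * x, fls_const k * y) \<in> TP"
  using TP_mobius[of x y "fls_const k" 0 0 1 k] by simp

text \<open>The relation \<open>Ac 0 = - 1 / A 0\<close> is itself a Moebius map of determinant 1,
  so exchanging the conjugates does not leave the orbit of the ordered pair.\<close>

lemma TP_swap: 
  assumes "(x, y) \<in> TP"
  shows "(y, x) \<in> TP"
proof -
  obtain a b c d k where *: "a \<in> Rset" "b \<in> Rset" "c \<in> Rset" "d \<in> Rset" "k \<noteq> 0"
    "a * d - b * c = fls_const k" "x = (a * A 0 + b) / (c * A 0 + d)" "y = (a * Ac 0 + b) / (c * Ac 0 + d)"
    using assms unfolding TP_def by blast
  have eq: "(u * v + w) / (u' * v + w') = (w * z + - u) / (w' * z + - u')"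
    if "v = - 1 / z" "z \<noteq> 0" for u v w u' w' z :: "'a fls"
  proof -
    have "(u * v + w) = (w * z + - u) / z" "(u' * v + w') = (w' * z + - u') / z"
      using that by (simp_all add: field_simps)
    then show ?thesis
      using that by simp
  qed
  have "x = (b * Ac 0 + - a) / (d * Ac 0 + - c)" "y = (b * A 0 + - a) / (d * A 0 + - c)"
    unfolding *(7,8) by (rule eq; simp add: Ac_def)+
  moreover have "b * - c - - a * d = fls_const k"
    using * by (simp add: algebra_simps)
  ultimately show ?thesis
    using TP_I[of b "- a" d "- c" k] * by auto
qed

lemma TP_A: "(A t, Ac t) \<in> TP"
proof -
  have "(A 0, Ac 0) \<in> TP"
    using TP_I[of 1 0 0 1 1] by simp
  moreover have "(A (t + 1), Ac (t + 1)) \<in> TP" if "(A t, Ac t) \<in> TP" for t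
  proof -
    have "A (t + 1) = 1 / (A t - letter (c t))" "Ac (t + 1) = 1 / (Ac t - letter (c t))"
      using A_step[of t] Ac_step[of t] by auto
    then show ?thesis
      using TP_inverse[OF TP_diff[OF that letter_Rset]] by simp
  qed
  moreover have "(A (t - 1), Ac (t - 1)) \<in> TP" if "(A t, Ac t) \<in> TP" for t
  proof -
    show ?thesis
      using TP_add[OF TP_inverse[OF that] letter_Rset, of "c (t - 1)"] A_step[of "t - 1"] Ac_step[of "t - 1"] by simp
  qed
  ultimately show ?thesis
    by (induction t rule: int_induct[where k = 0]) auto
qed

lemma Theta_eq: "Theta (A 0) = fst ` TP"
proof (intro equalityI subsetI)
  fix x
  assume "x \<in> Theta (A 0)"
  then obtain a b c d z u where *: "a \<in> Rset" "b \<in> Rset" "c \<in> Rset" "d \<in> Rset"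
    "u \<in> Rset" "(a * d - b * c) * u = 1" "z \<in> {A 0, Ac 0}" "x = (a * z + b) / (c * z + d)"
    unfolding Theta_def galconj_A by blast
  obtain k where k: "k \<noteq> 0" "a * d - b * c = fls_const k"
    using Rset_unit[of "a * d - b * c" u] * by blast
  have "(z, if z = A 0 then Ac 0 else A 0) \<in> TP"
    using *(7) TP_A[of 0] TP_swap[OF TP_A[of 0]] by auto
  from TP_mobius[OF this *(1-4) k] show "x \<in> fst ` TP"
    using *(8) by force
next
  fix x
  assume "x \<in> fst ` TP"
  then obtain a b c d k where *: "a \<in> Rset" "b \<in> Rset" "c \<in> Rset" "d \<in> Rset" "k \<noteq> 0"
    "a * d - b * c = fls_const k" "x = (a * A 0 + b) / (c * A 0 + d)"
    unfolding TP_def by auto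
  have "(a * d - b * c) * fls_const (inverse k) = 1"
    using * by simp
  then show "x \<in> Theta (A 0)"
    unfolding Theta_def using * by blast
qed

text \<open>Serret's theorem for reduced pairs: the degree of the lower left entry \<open>g\<close> drops after a forward
  step of the continued fraction if \<open>|d| \<ge> |g|\<close> and after a backward step otherwise.\<close>

lemma serret:
  assumes "a \<in> Rset" "b \<in> Rset" "g \<in> Rset" "d \<in> Rset" "k \<noteq> 0" "a * d - b * g = fls_const k"
    and "x = (a * A t + b) / (g * A t + d)" "y = (a * Ac t + b) / (g * Ac t + d)"
    and "1 \<le> dg x" "ub (-1) y"
  shows "\<exists>t u. u \<noteq> 0 \<and> x = fls_const u * A t \<and> y = fls_const u * Ac t"
  using assms(1-8)
\<comment> \<open>The shift by 1 ranks a nonzero constant \<open>g\<close> above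
  \<open>g = 0\<close>, whose \<open>dg\<close> is the default 0.\<close>
proof (induction "if g = 0 then 0 else nat (dg g) + 1" arbitrary: a b g d k t rule: less_induct)
  case less
  show ?case
  proof (cases "g = 0")
    case True
    then have "a * d = fls_const k"
      using less.prems by simp
    then have "a * (d * fls_const (inverse k)) = 1" "d * (a * fls_const (inverse k)) = 1"
      using less.prems by (simp_all flip: mult.assoc) (simp add: mult.commute[of d a])
    then obtain u v where uv: "a = fls_const u" "d = fls_const v" "u \<noteq> 0" "v \<noteq> 0"
      using Rset_unit[of a] Rset_unit[of d] less.prems by (metis Rset_mult Rset_const)
    have y: "y = fls_const (u / v) * Ac t + b * fls_const (inverse v)"
      "x = fls_const (u / v) * A t + b * fls_const (inverse v)"
      using less.prems(7,8) uv True
      by (simp_all add: add_divide_distrib divide_inverse fls_const_inverse algebra_simps flip: fls_const_mult_const)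
    \<comment> \<open>Here the map is affine. Since \<open>y\<close> and the scaled
      \<open>Ac t\<close> are both small, the polynomial translation is small and thus 0.\<close>
    have "ub (-1) (fls_const (u / v) * Ac t)"
      using uv by (simp add: ub_def dg_mult)
    then have "ub (-1) (b * fls_const (inverse v))"
      using ub_diff[OF assms(10)] y by fastforce
    then have "b * fls_const (inverse v) = 0"
      using less.prems by (intro Rset_ub_neg) auto
    then show ?thesis
      using y uv by (intro exI[of _ t] exI[of _ "u / v"]) auto
  next
    case g: False
    have gK: "g * A t + d \<noteq> 0" "g * Ac t + d \<noteq> 0"
      using denominator_nonzero less.prems(3,4) g by blast+
    have dgg: "0 \<le> dg g"
      using g less.prems Rset_dg_nonneg by auto
    show ?thesis
    proof (cases "d \<noteq> 0 \<and> dg g \<le> dg d")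
      case True
      have "dg (g * Ac t) = dg g - 1"
        using g by (simp add: dg_mult)
      then have dgc: "dg (g * Ac t + d) = dg d"
        using True dg_add_less(6)[of d "g * Ac t"] by auto
      have num: "a * A t + b = x * (g * A t + d)" "a * Ac t + b = y * (g * Ac t + d)"
        using less.prems(7,8) gK by auto
      \<comment> \<open>The determinant links the differences of the two pairs; both differences are
        dominated by their large member, which gives the balance of exponents
        \<open>sum\<close>.\<close>
      have "fls_const k * (A t - Ac t) = (a * A t + b) * (g * Ac t + d) - (a * Ac t + b) * (g * A t + d)"
        using less.prems(6) by (simp add: algebra_simps flip: less.prems(6))
      also have "\<dots> = (x - y) * ((g * A t + d) * (g * Ac t + d))"
        unfolding num by (simp add: algebra_simps)
      finally have eq: "fls_const k * (A t - Ac t) = (x - y) * ((g * A t + d) * (g * Ac t + d))" .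
      have "x \<noteq> 0" "y = 0 \<or> dg y < dg x"
        using assms(9,10) by (auto simp: dg_def ub_def)
      then have xy: "x - y \<noteq> 0" "dg (x - y) = dg x"
        using dg_add_less(3,4) by auto
      have "dg (fls_const k * (A t - Ac t)) = 1"
        using less.prems(5) dg_add_less(3,4)[of "A t" "Ac t"] by (simp add: dg_mult)
      then have sum: "1 = dg x + dg (g * A t + d) + dg d"
        using arg_cong[OF eq, of dg] xy gK dgc by (simp add: dg_mult)
      have gA: "g * A t \<noteq> 0" "dg (g * A t) = dg g + 1"
        using g by (auto simp: dg_mult)
      \<comment> \<open>Without cancellation between \<open>g * A t\<close> and \<open>d\<close> the
        balance \<open>sum\<close> would be exceeded; cancellation requires equal exponents.\<close>
      have dd: "dg d = dg g + 1"
      proof (rule ccontr)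
        assume "dg d \<noteq> dg g + 1"
        then have "dg (g * A t + d) \<ge> dg g + 1"
          using dg_add_less(2)[of "g * A t" d] dg_add_less(6)[of d "g * A t"] gA True by linarith
        then show False
          using sum assms(9) dgg True by linarith
      qed
      \<comment> \<open>The lower left entry after a forward step. Both terms on the right have
        exponent below \<open>dg g\<close>: the first by the balance \<open>sum\<close>, the second
        because \<open>1 / A (t + 1)\<close> is small.\<close>
      have new: "g * letter (c t) + d = (g * A t + d) - g * (1 / A (t + 1))"
        using A_step[of t] by (simp add: algebra_simps)
      have "ub (dg g - 1) (g * (1 / A (t + 1)))"
        using ub_mult[OF ub_dg A_small, of g] by simp
      moreover have "ub (dg g - 1) (g * A t + d)"
        using sum assms(9) dd dgg by (simp add: ub_def)
      ultimately have new': "ub (dg g - 1) (g * letter (c t) + d)"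
        unfolding new by (rule ub_diff[rotated])
      have nonneg: "g * letter (c t) + d = 0 \<or> 0 \<le> dg (g * letter (c t) + d)"
      proof -
        have "g * letter (c t) + d \<in> Rset"
          using less.prems(3,4) by (intro Rset_add Rset_mult letter_Rset)
        then show ?thesis
          using Rset_dg_nonneg by blast
      qed
      have t1: "A t = (letter (c t) * A (t + 1) + 1) / (1 * A (t + 1) + 0)"
        "Ac t = (letter (c t) * Ac (t + 1) + 1) / (1 * Ac (t + 1) + 0)"
        using A_step[of t] Ac_step[of t] by (simp_all add: field_simps)
      have x: "x = ((a * letter (c t) + b * 1) * A (t + 1) + (a * 1 + b * 0)) / ((g * letter (c t) + d * 1) * A (t + 1) + (g * 1 + d * 0))"
        "y = ((a * letter (c t) + b * 1) * Ac (t + 1) + (a * 1 + b * 0)) / ((g * letter (c t) + d * 1) * Ac (t + 1) + (g * 1 + d * 0))"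
        unfolding less.prems(7,8) t1 by (rule mobius_comp; simp)+
      show ?thesis
      proof (rule less.hyps[OF _ _ _ _ _ _ _ x])
        show "(if g * letter (c t) + d * 1 = 0 then 0 else nat (dg (g * letter (c t) + d * 1)) + 1)
            < (if g = 0 then 0 else nat (dg g) + 1)"
          using new' dgg g nonneg by (auto simp: ub_def)
        show "(a * letter (c t) + b * 1) * (g * 1 + d * 0) - (a * 1 + b * 0) * (g * letter (c t) + d * 1) = fls_const (- k)"
          using less.prems(6) unfolding fls_const_uminus less.prems(6)[symmetric] by (simp add: algebra_simps)
      qed (use less.prems in auto)
    next
      case False
      define e where "e = - letter (c (t - 1))"
      have t1: "A t = (0 * A (t - 1) + 1) / (1 * A (t - 1) + e)"
        "Ac t = (0 * Ac (t - 1) + 1) / (1 * Ac (t - 1) + e)"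
        using A_step[of "t - 1"] Ac_step[of "t - 1"] by (simp_all add: e_def)
      have nz: "1 * A (t - 1) + e \<noteq> 0" "1 * Ac (t - 1) + e \<noteq> 0"
        using A_step[of "t - 1"] Ac_step[of "t - 1"] by (simp_all add: e_def)
      have x: "x = ((a * 0 + b * 1) * A (t - 1) + (a * 1 + b * e)) / ((g * 0 + d * 1) * A (t - 1) + (g * 1 + d * e))"
        "y = ((a * 0 + b * 1) * Ac (t - 1) + (a * 1 + b * e)) / ((g * 0 + d * 1) * Ac (t - 1) + (g * 1 + d * e))"
        unfolding less.prems(7,8) t1 by (rule mobius_comp, fact nz)+
      show ?thesis
      proof (rule less.hyps[OF _ _ _ _ _ _ _ x])
        show "(if g * 0 + d * 1 = 0 then 0 else nat (dg (g * 0 + d * 1)) + 1)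
            < (if g = 0 then 0 else nat (dg g) + 1)"
          using False g dgg Rset_dg_nonneg[OF less.prems(4)] by auto
        show "(a * 0 + b * 1) * (g * 1 + d * e) - (a * 1 + b * e) * (g * 0 + d * 1) = fls_const (- k)"
          using less.prems(6) unfolding fls_const_uminus less.prems(6)[symmetric] by (simp add: algebra_simps)
      qed (use less.prems in \<open>auto simp: e_def\<close>)
    qed
  qed
qed

lemma TP_reduced:
  assumes "(x, y) \<in> TP" "1 \<le> dg x" "ub (-1) y"
  obtains t u where "u \<noteq> 0" "x = fls_const u * A t" "y = fls_const u * Ac t"
proof -
  obtain a b c d k where *: "a \<in> Rset" "b \<in> Rset" "c \<in> Rset" "d \<in> Rset" "k \<noteq> 0"
    "a * d - b * c = fls_const k" "x = (a * A 0 + b) / (c * A 0 + d)" "y = (a * Ac 0 + b) / (c * Ac 0 + d)"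
    using assms unfolding TP_def by blast
  show ?thesis
    using serret[OF * assms(2,3)] that by blast
qed

lemma TP_reduced_I: "u \<noteq> 0 \<Longrightarrow> (fls_const u * A t, fls_const u * Ac t) \<in> TP"
  by (rule TP_scale[OF TP_A])

text \<open>Translating by the integral part of \<open>y\<close> keeps the difference. If its
  exponent exceeded 1, the translated pair would be reduced, but the large member of a reduced pair
  has exponent exactly 1, the degree of a letter.\<close>

lemma TP_height:
  assumes "(x, y) \<in> TP"
  shows "dg (x - y) \<le> 1"
proof (rule ccontr)
  assume *: "\<not> dg (x - y) \<le> 1"
  obtain a where a: "a \<in> Rset" "ub (-1) (y - a)"
    using floor_exists by blast
  have "x - y \<noteq> 0"
    using TP_irrational(3)[OF assms] by simp
  then have "dg ((x - y) + (y - a)) = dg (x - y)"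
    using * a(2) by (intro dg_add_dominant) (auto intro: ub_mono)
  then have x: "dg (x - a) = dg (x - y)"
    by simp
  have "1 \<le> dg (x - a)"
    using x * by simp
  from TP_reduced[OF TP_diff[OF assms a(1)] this a(2)]
  obtain t u where "u \<noteq> 0" "x - a = fls_const u * A t"
    by blast
  then have "dg (x - a) = 1"
    by (simp add: dg_mult)
  then show False
    using x * by simp
qed

end

section \<open>Continued fraction of the approximated series\<close>

locale continued_fraction =
  fixes f e :: "'a::{field,finite} fls" and a x :: "nat \<Rightarrow> 'a fls"
  assumes f_eq: "f = e + x 0"
    and e_Rset: "e \<in> Rset"
    and a_Rset: "\<And>n. a n \<in> Rset"
    and a_dg: "\<And>n. 1 \<le> dg (a n)"
    and x_step: "\<And>n. x n = 1 / (a n + x (Suc n))"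
    and x_small: "\<And>n. ub (-1) (x n)"
begin

lemma x_irrational: "x n \<notin> Kset"
  using cf_irrational[of a x] a_Rset a_dg x_small x_step by blast

lemma x_nonzero [simp]: "x n \<noteq> 0"
  using x_irrational[of n] by auto

lemma dg_x: "dg (x n) = - dg (a n)"
  using dg_cf(1)[OF a_dg x_small, of n "Suc n"] x_step[of n] by simp

lemma inverse_x: "1 / x n = a n + x (Suc n)"
  using x_step[of n] by simp

lemma a_nonzero [simp]: "a n \<noteq> 0"
  using a_dg[of n] by (auto simp: dg_def)

lemma f_irrational: "f \<notin> Kset"
proof
  assume "f \<in> Kset"
  then have "f - e \<in> Kset"
    using e_Rset Rset_subset_Kset by auto
  then show False
    using x_irrational[of 0] by (simp add: f_eq)
qed

text \<open>\<open>tail n\<close> is the Moebius map that sends \<open>f\<close> to its complete quotient \<open>1 / x n\<close>; it sends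
  \<open>\<infinity>\<close> to \<open>- past n\<close>.\<close>

primrec past :: "nat \<Rightarrow> 'a fls" where
  "past 0 = 0"
| "past (Suc n) = 1 / (a n + past n)"

primrec tail :: "nat \<Rightarrow> 'a fls \<Rightarrow> 'a fls" where
  "tail 0 y = 1 / (y - e)"
| "tail (Suc n) y = 1 / (tail n y - a n)"

text \<open>The exponent of \<open>|Q|\<^sup>2\<close> for the denominator \<open>Q\<close> of the \<open>n\<close>-th convergent.\<close>

definition scale :: "nat \<Rightarrow> int" where
  "scale n = 2 * (\<Sum>i<n. dg (a i))"

lemma scale_ge: "2 * int n \<le> scale n"
proof -
  have "(\<Sum>i<n. 1) \<le> (\<Sum>i<n. dg (a i))"
    by (rule sum_mono) (rule a_dg)
  then show ?thesis
    by (simp add: scale_def)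
qed

lemma past_small: "ub (-1) (past n)"
  by (induction n) (auto intro!: dg_cf a_dg)

lemma past_Kset: "past n \<in> Kset"
  by (induction n) (auto intro!: Kset_divide Kset_add Rset_subset_Kset[OF a_Rset])

lemma tail_f: "tail n f = 1 / x n"
proof (induction n)
  case 0
  show ?case by (simp add: f_eq)
next
  case (Suc n)
  then show ?case using inverse_x[of n] by simp
qed

lemma tail_irrational: "y \<notin> Kset \<Longrightarrow> tail n y \<notin> Kset"
proof (induction n)
  case 0
  have False if "tail 0 y \<in> Kset"
  proof -
    have "1 / tail 0 y + e \<in> Kset"
      using that e_Rset Rset_subset_Kset by blast
    then show False
      using 0 by simp
  qed
  then show ?case by blast
next
  case (Suc n)
  have False if "tail (Suc n) y \<in> Kset"
  proof -
    have "1 / tail (Suc n) y + a n \<in> Kset"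
      using that a_Rset Rset_subset_Kset by blast
    then show False
      using Suc by simp
  qed
  then show ?case by blast
qed

lemma irrational_add_nonzero: "y \<notin> Kset \<Longrightarrow> z \<in> Kset \<Longrightarrow> y + z \<noteq> 0"
  using lin_nonzero[of y 1 z] by simp

lemma irrational_diff_nonzero: "y \<notin> Kset \<Longrightarrow> z \<in> Kset \<Longrightarrow> y - z \<noteq> 0"
  by auto

lemma tail_eq: "y \<notin> Kset \<Longrightarrow> tail n y = a n + 1 / tail (Suc n) y"
  using irrational_diff_nonzero[OF tail_irrational Rset_subset_Kset[OF a_Rset]] by simp

lemma tail_inj: "y \<notin> Kset \<Longrightarrow> z \<notin> Kset \<Longrightarrow> tail n y = tail n z \<Longrightarrow> y = z"
proof (induction n)
  case 0
  then show ?case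
    by simp
next
  case (Suc n)
  then have "tail n y = tail n z"
    using tail_eq[of y n] tail_eq[of z n] by metis
  then show ?case
    using Suc by blast
qed

text \<open>How a Moebius map of constant determinant changes distances: pulling back by
  \<open>tail n\<close> divides by the distances of both points to the image \<open>- past n\<close>
  of infinity, and by the square of the convergent's denominator.\<close>

lemma dg_diff_tail:
  assumes "y \<notin> Kset" "z \<notin> Kset" "y \<noteq> z"
  shows "dg (y - z) = dg (tail n y - tail n z) - scale n - dg (tail n y + past n) - dg (tail n z + past n)"
proof (induction n)
  case 0
  define Y Z where "Y = tail 0 y" and "Z = tail 0 z"
  have "Y \<notin> Kset" "Z \<notin> Kset" "Y \<noteq> Z"
    unfolding Y_def Z_def using tail_irrational assms tail_inj by blast+
  then have nz: "Y \<noteq> 0" "Z \<noteq> 0" "Z - Y \<noteq> 0"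
    by auto
  have "y - z = 1 / Y - 1 / Z"
    by (simp add: Y_def Z_def)
  also have "\<dots> = (Z - Y) / (Y * Z)"
    using nz by (simp add: field_simps)
  finally have "y - z = (Z - Y) / (Y * Z)" .
  then have "dg (y - z) = dg (Z - Y) - dg Y - dg Z"
    using nz by (simp add: dg_divide dg_mult)
  then show ?case
    unfolding Y_def[symmetric] Z_def[symmetric] by (simp add: scale_def dg_minus_commute[of Z Y])
next
  case (Suc n)
  define Y Z where "Y = tail (Suc n) y" and "Z = tail (Suc n) z"
  have irr: "Y \<notin> Kset" "Z \<notin> Kset" "Y \<noteq> Z"
    unfolding Y_def Z_def using tail_irrational assms tail_inj by blast+
  then have nz: "Y \<noteq> 0" "Z \<noteq> 0" "Z - Y \<noteq> 0"
    by auto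
  have yz: "tail n y = a n + 1 / Y" "tail n z = a n + 1 / Z"
    unfolding Y_def Z_def using tail_eq assms by blast+
  then have "tail n y - tail n z = 1 / Y - 1 / Z"
    by (simp del: tail.simps)
  also have "\<dots> = (Z - Y) / (Y * Z)"
    using nz by (simp add: field_simps)
  finally have d: "tail n y - tail n z = (Z - Y) / (Y * Z)" .
  have s: "past (Suc n) \<noteq> 0" "dg (past (Suc n)) = - dg (a n)" "a n + past n = 1 / past (Suc n)"
    using dg_cf[OF a_dg past_small] by auto
  have sum: "w + past n = (W + past (Suc n)) / (past (Suc n) * W)" if "w = a n + 1 / W" "W \<noteq> 0" for w W
  proof -
    have "w + past n = (a n + past n) + 1 / W"
      using that by simp
    also have "\<dots> = 1 / past (Suc n) + 1 / W"
      unfolding s(3) ..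
    finally show ?thesis
      using that(2) s(1) by (simp add: field_simps del: past.simps)
  qed
  have "dg (w + past n) = dg (W + past (Suc n)) + dg (a n) - dg W" if "w = a n + 1 / W" "W \<notin> Kset" for w W
  proof -
    have "W \<noteq> 0"
      using that(2) by auto
    moreover have "W + past (Suc n) \<noteq> 0"
      by (rule irrational_add_nonzero[OF that(2) past_Kset])
    ultimately show ?thesis
      using sum[OF that(1)] s by (simp add: dg_divide dg_mult del: past.simps)
  qed
  note sums = this[OF yz(1) irr(1)] this[OF yz(2) irr(2)]
  have "dg (tail n y - tail n z) = dg (Y - Z) - dg Y - dg Z"
    unfolding d using nz by (simp add: dg_divide dg_mult dg_minus_commute[of Z Y])
  moreover have "scale (Suc n) = scale n + 2 * dg (a n)"
    by (simp add: scale_def)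
  ultimately show ?case
    using Suc sums unfolding Y_def[symmetric] Z_def[symmetric] by simp
qed

text \<open>If \<open>y\<close> shared all integral parts with \<open>f\<close>, uniqueness of the
  expansion would give \<open>y = f\<close>.\<close>

lemma tail_diverges:
  assumes "y \<notin> Kset" "y \<noteq> f"
  shows "\<not> ub (-1) (y - e) \<or> (\<exists>n. \<not> ub (-1) (tail n y - a n))"
proof (rule ccontr)
  assume *: "\<not> ?thesis"
  have "1 / tail 0 y = x 0"
  proof (rule cf_unique[where a = a and \<sigma> = Suc and x = "\<lambda>n. 1 / tail n y" and y = x])
    fix n
    show "ub (-1) (1 / tail n y)"
      using * by (cases n) auto
    show "1 / tail n y = 1 / (a n + 1 / tail (Suc n) y)"
      using tail_eq[OF assms(1), of n] by simp
  qed (rule a_dg x_small x_step)+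
  then show False
    using assms by (simp add: f_eq diff_eq_eq add.commute)
qed

text \<open>Once \<open>y\<close> leaves the expansion of \<open>f\<close>, its tail has exponent at
  most 0, and from then on \<open>a n\<close> dominates it at every step.\<close>

lemma tail_eventually_small:
  assumes "y \<notin> Kset" "y \<noteq> f"
  obtains N where "\<And>n. N \<le> n \<Longrightarrow> ub (-1) (tail n y)"
proof -
  have less: "\<exists>n. ub 0 (tail n y)"
  proof (cases "ub (-1) (y - e)")
    case True
    then obtain n where "\<not> ub (-1) (tail n y - a n)"
      using tail_diverges assms by blast
    then have "ub 0 (tail (Suc n) y)"
      by (auto simp: not_ub ub_def dg_divide)
    then show ?thesis by blast
  next
    case False
    then have "ub 0 (tail 0 y)"
      by (auto simp: not_ub ub_def dg_divide)
    then show ?thesis by blast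
  qed
  have step: "ub (-1) (tail (Suc n) y)" if "ub 0 (tail n y)" for n
  proof -
    have "tail n y = 0 \<or> dg (tail n y) < dg (a n)"
      using that a_dg[of n] by (auto simp: ub_def)
    then have "tail n y - a n \<noteq> 0" "dg (tail n y - a n) = dg (a n)"
      using dg_add_less(7,8)[of "a n" "tail n y"] by auto
    then show ?thesis
      using a_dg[of n] by (simp add: ub_def dg_divide)
  qed
  obtain N where N: "ub 0 (tail N y)"
    using less by blast
  have "ub (-1) (tail n y)" if "Suc N \<le> n" for n
    using that
  proof (induction n rule: dec_induct)
    case base
    show ?case by (rule step[OF N])
  next
    case (step n)
    then show ?case
      using \<open>\<And>n. ub 0 (tail n y) \<Longrightarrow> ub (-1) (tail (Suc n) y)\<close> ub_mono[of "-1" "tail n y" 0] by simp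
  qed
  then show ?thesis
    by (rule that)
qed

end

lemma continued_fraction_exists:
  fixes f :: "'a::{field,finite} fls"
  assumes "f \<notin> Kset"
  obtains e a x where "continued_fraction f e a x"
proof -
  define fl :: "'a fls \<Rightarrow> 'a fls" where "fl g = (SOME a. a \<in> Rset \<and> ub (-1) (g - a))" for g
  have fl: "fl g \<in> Rset" "ub (-1) (g - fl g)" for g
  proof -
    have "\<exists>a. a \<in> Rset \<and> ub (-1) (g - a)"
      using floor_exists[of g] by blast
    then show "fl g \<in> Rset" "ub (-1) (g - fl g)"
      unfolding fl_def by (metis (mono_tags, lifting) someI_ex)+
  qed
  define x where "x = rec_nat (f - fl f) (\<lambda>_ y. 1 / y - fl (1 / y))"
  define a where "a n = fl (1 / x n)" for n
  have x0: "x 0 = f - fl f" and xSuc: "x (Suc n) = 1 / x n - a n" for n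
    by (simp_all add: x_def a_def)
  have irr: "x n \<notin> Kset" for n
  proof (induction n)
    case 0
    show ?case
    proof
      assume "x 0 \<in> Kset"
      then have "x 0 + fl f \<in> Kset"
        using Rset_subset_Kset[OF fl(1)] by blast
      then show False using assms by (simp add: x0)
    qed
  next
    case (Suc n)
    show ?case
    proof
      assume "x (Suc n) \<in> Kset"
      then have "1 / (x (Suc n) + a n) \<in> Kset"
        using Rset_subset_Kset[OF fl(1)] unfolding a_def by (intro Kset_divide Kset_add Kset_1)
      then show False using Suc by (simp add: xSuc)
    qed
  qed
  have small: "ub (-1) (x n)" for n
    by (cases n) (simp_all add: x0 xSuc a_def fl)
  have nz: "x n \<noteq> 0" for n
    using irr[of n] by auto
  have "1 \<le> dg (a n)" for n
  proof -
    have "1 \<le> dg (1 / x n)"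
      using small[of n] nz by (auto simp: dg_divide ub_def)
    then have "dg (a n) = dg (1 / x n)"
      using nz fl(2)[of "1 / x n"] unfolding a_def
      by (intro dg_close(2)) (auto simp: ub_minus_commute intro: ub_mono)
    then show ?thesis
      using \<open>1 \<le> dg (1 / x n)\<close> by simp
  qed
  then have "continued_fraction f (fl f) a x"
    using nz by unfold_locales (auto simp: x0 xSuc small fl a_def)
  then show ?thesis by (rule that)
qed

section \<open>Conjugate pairs seen along the expansion of \<open>f\<close>\<close>

locale approximation = quadratic_line c p A + continued_fraction f e a x
  for c :: "int \<Rightarrow> 'a::{field,finite}" and p A and f e :: "'a fls" and a x
begin

lemma tail_TP: "(y, z) \<in> TP \<Longrightarrow> (tail n y, tail n z) \<in> TP"
  by (induction n) (auto intro!: TP_inverse TP_diff a_Rset e_Rset)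

lemma tail_TP_surj:
  assumes "(Y, Z) \<in> TP"
  obtains y z where "(y, z) \<in> TP" "tail n y = Y" "tail n z = Z"
proof -
  have "\<exists>y z. (y, z) \<in> TP \<and> tail n y = Y \<and> tail n z = Z"
    using assms
  proof (induction n arbitrary: Y Z)
    case 0
    show ?case
      by (intro exI[of _ "e + 1 / Y"] exI[of _ "e + 1 / Z"]) (auto intro!: TP_add TP_inverse 0 e_Rset)
  next
    case (Suc n)
    have "(a n + 1 / Y, a n + 1 / Z) \<in> TP"
      by (auto intro!: TP_add TP_inverse Suc a_Rset)
    then obtain y z where "(y, z) \<in> TP" "tail n y = a n + 1 / Y" "tail n z = a n + 1 / Z"
      using Suc.IH by blast
    then show ?case
      by (intro exI[of _ y] exI[of _ z]) simp
  qed
  then show ?thesis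
    using that by blast
qed

text \<open>Situation at the place where \<open>P'\<close> leaves the expansion of \<open>G\<close>
  while \<open>P\<close> still follows it. By \<open>TP_height\<close> the exponent of
  \<open>P' - a0\<close> is 1 or 0. If it is 1, one step gives a reduced pair. If it is 0, the
  height bound forces \<open>P1\<close> and \<open>a1\<close> to have degree 1, and the margin 3 is
  exactly what lets \<open>P1\<close> share the quotient \<open>a1\<close>, so that a second step
  suffices.\<close>

lemma reduced_after_two_steps:
  assumes TP: "(P, P') \<in> TP" and a0: "a0 \<in> Rset" and a1: "a1 \<in> Rset" "1 \<le> dg a1"
    and G: "G = a0 + y" "y = 1 / (a1 + y1)" "ub (-1) y" "ub (-1) y1"
    and P': "\<not> ub (-1) (P' - a0)" and close: "ub (dg (P - P') - 3) (G - P)"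
  shows "(1 \<le> dg (1 / (P - a0)) \<and> ub (-1) (1 / (P' - a0))) \<or>
    (1 \<le> dg (1 / (1 / (P - a0) - a1)) \<and> ub (-1) (1 / (1 / (P' - a0) - a1)))"
proof -
  define P1 P1' where "P1 = 1 / (P - a0)" and "P1' = 1 / (P' - a0)"
  have TP1: "(P1, P1') \<in> TP"
    unfolding P1_def P1'_def by (intro TP_inverse TP_diff TP a0)
  have nz: "P - a0 \<noteq> 0" "P' - a0 \<noteq> 0" "P - P' \<noteq> 0" "P1 \<noteq> 0" "P1' \<noteq> 0"
    using TP_irrational(1-3)[OF TP] TP_irrational(1-3)[OF TP1] Rset_subset_Kset[OF a0] by auto
  have h: "dg (P - P') \<le> 1" "dg (P1 - P1') \<le> 1"
    using TP_height TP TP1 by auto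
  have "ub (-1) (G - P)"
    using close by (rule ub_mono) (use h in simp)
  then have "ub (-1) ((G - a0) - (G - P))"
    by (rule ub_diff[rotated]) (simp add: G(1,3))
  then have Pa: "dg (P - a0) \<le> - 1"
    using nz by (simp add: ub_def)
  have Pa': "0 \<le> dg (P' - a0)"
    using P' by (simp add: not_ub)
  have "dg ((P' - a0) - (P - a0)) = dg (P' - a0)"
    using dg_add_less(4)[of "P' - a0" "P - a0"] nz Pa Pa' by simp
  then have eq: "dg (P' - a0) = dg (P - P')"
    by (simp add: dg_minus_commute)
  have dP1: "dg P1 = - dg (P - a0)" "dg P1' = - dg (P' - a0)"
    using nz by (simp_all add: P1_def P1'_def dg_divide)
  show ?thesis
  proof (cases "dg (P' - a0) = 1")
    case True
    then show ?thesis
      using dP1 Pa by (simp add: ub_def flip: P1_def P1'_def)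
  next
    case False
    then have z: "dg (P' - a0) = 0" "dg (P - P') = 0"
      using Pa' eq h by auto
    have "dg (P1 - P1') = dg P1"
      using dg_add_less(4)[of P1 P1'] nz dP1 Pa z by auto
    then have one: "dg P1 = 1" "dg (P - a0) = - 1"
      using h dP1 Pa by auto
    have "ub (dg (P - a0) - 1) (y - (P - a0))"
      using close one z G(1) by (auto simp: algebra_simps intro: ub_mono)
    then have y: "y \<noteq> 0" "dg y = - 1"
      using dg_close[OF nz(1)] one by auto
    then have a1y: "dg a1 = 1" "a1 + y1 \<noteq> 0" "1 / y = a1 + y1"
      using dg_cf[OF a1(2) G(4)] G(2) by auto
    have "P1 - a1 = (P1 - 1 / y) + y1"
      using a1y by simp
    also have "P1 - 1 / y = (G - P) / ((P - a0) * y)"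
      using y nz by (simp add: P1_def G(1) field_simps)
    also have "ub (-1) ((G - P) / ((P - a0) * y) + y1)"
      using y nz close z one by (intro ub_add G) (simp add: ub_divide_iff dg_mult)
    finally have "ub (-1) (P1 - a1)" .
    moreover have "P1 - a1 \<noteq> 0"
      using TP_irrational(1)[OF TP1] Rset_subset_Kset[OF a1(1)] by auto
    moreover have "a1 \<noteq> 0"
      using a1 by (auto simp: dg_def)
    then have "P1' - a1 \<noteq> 0" "dg (P1' - a1) = 1"
      using dg_add_less(7,8)[of a1 P1'] a1y dP1 z by auto
    ultimately have "1 \<le> dg (1 / (P1 - a1))" "ub (-1) (1 / (P1' - a1))"
      by (auto simp: ub_def dg_divide)
    then show ?thesis
      unfolding P1_def P1'_def by blast
  qed
qed

lemma dg_past: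
  assumes "y \<noteq> 0" "0 \<le> dg y"
  shows "dg (y + past n) = dg y"
  using dg_add_less(2)[of y "past n"] past_small[of n] assms by (auto simp: ub_def)

text \<open>In the distance formulas for \<open>b, b'\<close> and for \<open>f, b\<close> the scale
  and the factor of \<open>b\<close> are the same and cancel.\<close>

lemma ratio_tail:
  assumes "(b, b') \<in> TP" "f \<noteq> b"
  shows "dg (b - b') - dg (f - b) =
    dg (tail n b - tail n b') - dg (tail n b' + past n) - dg (1 / x n - tail n b) + dg (a n)"
proof -
  note irr = TP_irrational[OF assms(1)]
  have "dg (1 / x n + past n) = dg (a n)"
    using dg_past[of "1 / x n"] dg_x[of n] a_dg[of n] by (simp add: dg_divide)
  then show ?thesis
    using dg_diff_tail[OF irr(1,2,3), of n] dg_diff_tail[OF f_irrational irr(1) assms(2), of n]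
    by (simp add: tail_f)
qed

text \<open>The pair becomes reduced shortly after \<open>b'\<close> leaves the expansion of
  \<open>f\<close>, at the least \<open>n\<close> whose quotient \<open>a n\<close> is not
  shared.\<close>

lemma reduced_tail_exists:
  assumes TP: "(b, b') \<in> TP" and neq: "f \<noteq> b" "f \<noteq> b'" and close: "3 \<le> dg (b - b') - dg (f - b)"
  shows "\<exists>n. 1 \<le> dg (tail n b) \<and> ub (-1) (tail n b')"
proof (cases "ub (-1) (b' - e)")
  case False
  have "ub (dg (b - b') - 3) (f - b)"
    using close by (simp add: ub_def)
  from reduced_after_two_steps[OF TP e_Rset a_Rset a_dg f_eq x_step x_small x_small False this]
  have "(1 \<le> dg (tail 0 b) \<and> ub (-1) (tail 0 b')) \<or> (1 \<le> dg (tail (Suc 0) b) \<and> ub (-1) (tail (Suc 0) b'))"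
    by simp
  then show ?thesis by blast
next
  case True
  note irr = TP_irrational[OF TP]
  define n where "n = (LEAST n. \<not> ub (-1) (tail n b' - a n))"
  have ex: "\<exists>n. \<not> ub (-1) (tail n b' - a n)"
    using tail_diverges[OF irr(2)] neq True by auto
  then have n: "\<not> ub (-1) (tail n b' - a n)"
    unfolding n_def by (rule LeastI_ex)
  have less: "ub (-1) (tail i b' - a i)" if "i < n" for i
    using that not_less_Least unfolding n_def by blast
  define B B' where "B = tail n b" and "B' = tail n b'"
  have TPn: "(B, B') \<in> TP"
    unfolding B_def B'_def by (rule tail_TP[OF TP])
  note irrn = TP_irrational[OF TPn]
  have nz: "B' \<noteq> 0" "B - B' \<noteq> 0"
    using irrn by auto
  have B': "1 \<le> dg B'"
  proof (cases n)
    case 0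
    then have "B' = 1 / (b' - e)" "b' - e \<noteq> 0"
      using irr(2) e_Rset Rset_subset_Kset by (auto simp: B'_def)
    then show ?thesis
      using True by (auto simp: ub_def dg_divide)
  next
    case (Suc m)
    then have "B' = 1 / (tail m b' - a m)" "tail m b' - a m \<noteq> 0"
      using irrational_diff_nonzero[OF tail_irrational[OF irr(2)] Rset_subset_Kset[OF a_Rset]] by (auto simp: B'_def)
    then show ?thesis
      using less[of m] Suc by (auto simp: ub_def dg_divide)
  qed
  have past: "dg (B' + past n) = dg B'"
    using dg_past[of B'] B' nz by simp
  have ratio: "3 \<le> dg (B - B') - dg B' - dg (1 / x n - B) + dg (a n)"
    using close ratio_tail[OF TP neq(1), of n] past by (simp add: B_def B'_def)
  have h: "dg (B - B') \<le> 1"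
    by (rule TP_height[OF TPn])
  \<comment> \<open>Otherwise \<open>1 / x n\<close> dominates both members of the pair, because
    these are at distance at most \<open>q\<close>, and the overlap would be at most
    \<open>1 - dg B'\<close>, hence not positive.\<close>
  have "dg (a n) \<le> dg B'"
  proof (rule ccontr)
    assume *: "\<not> dg (a n) \<le> dg B'"
    have F: "dg (1 / x n) = dg (a n)" "1 / x n \<noteq> 0"
      by (simp_all add: dg_divide dg_x)
    have "dg (1 / x n - B') = dg (a n)" "1 / x n - B' \<noteq> 0"
      using dg_add_less(3,4)[of "1 / x n" B'] F * by auto
    moreover have "dg ((1 / x n - B') - (B - B')) = dg (1 / x n - B')"
      using dg_add_less(4)[of "1 / x n - B'" "B - B'"] calculation * B' h by simp
    ultimately have "dg (1 / x n - B) = dg (a n)"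
      by simp
    then show False
      using ratio h B' by simp
  qed
  then have "ub (dg (B - B') - 3) (1 / x n - B)"
    using ratio by (simp add: ub_def)
  from reduced_after_two_steps[OF TPn a_Rset a_Rset a_dg inverse_x x_step x_small x_small n[folded B'_def] this]
  have "(1 \<le> dg (tail (Suc n) b) \<and> ub (-1) (tail (Suc n) b')) \<or>
      (1 \<le> dg (tail (Suc (Suc n)) b) \<and> ub (-1) (tail (Suc (Suc n)) b'))"
    by (simp add: B_def B'_def)
  then show ?thesis by blast
qed

text \<open>For a reduced pair the overlap splits at a vertex into the agreement with the future
  \<open>x n\<close> and the agreement with the past. The distance of the pair depends only on
  \<open>scale n\<close> and the agreement with the past.\<close>

lemma reduced_tail:
  assumes TP: "(b, b') \<in> TP" and neq: "f \<noteq> b" and u: "u \<noteq> 0"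
    and B: "tail n b = fls_const u * A t" "tail n b' = fls_const u * Ac t"
  shows "dg (b - b') - dg (f - b) = - dg (x n - 1 / (fls_const u * A t)) - dg (past n + fls_const u * Ac t)"
    and "dg (b - b') = - scale n - dg (past n + fls_const u * Ac t)"
    and "x n \<noteq> 1 / (fls_const u * A t)" "past n + fls_const u * Ac t \<noteq> 0"
proof -
  define B B' where "B = fls_const u * A t" and "B' = fls_const u * Ac t"
  have dB: "B \<noteq> 0" "B' \<noteq> 0" "dg B = 1" "dg B' = - 1"
    using u by (simp_all add: B_def B'_def dg_mult)
  then have d: "dg (B - B') = 1" "dg (B + past n) = 1"
    using dg_add_less(4)[of B B'] dg_past[of B n] by auto
  note irr = TP_irrational[OF TP]
  show neqB: "x n \<noteq> 1 / (fls_const u * A t)"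
    using tail_inj[OF f_irrational irr(1), of n] neq B tail_f[of n] by auto
  show "past n + fls_const u * Ac t \<noteq> 0"
    using irrational_add_nonzero[OF tail_irrational[OF irr(2)] past_Kset, of n] B by (simp add: add.commute)
  have "x n - 1 / B = (B - 1 / x n) * (x n / B)"
    using dB by (simp add: field_simps)
  moreover have "B - 1 / x n \<noteq> 0"
    using neqB unfolding B_def[symmetric] by auto
  ultimately have "dg (x n - 1 / B) = dg (B - 1 / x n) - dg (a n) - 1"
    using dB by (simp add: dg_mult dg_divide dg_x)
  then show "dg (b - b') - dg (f - b) = - dg (x n - 1 / (fls_const u * A t)) - dg (past n + fls_const u * Ac t)"
    using ratio_tail[OF TP neq, of n] d
    by (simp add: B add.commute dg_minus_commute[of B] flip: B_def B'_def)
  show "dg (b - b') = - scale n - dg (past n + fls_const u * Ac t)"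
    using dg_diff_tail[OF irr(1-3), of n] d by (simp add: B add.commute flip: B_def B'_def)
qed

end

section \<open>Words and cylinders\<close>

text \<open>\<open>cyl u v z\<close>: the continued fraction of \<open>z\<close> starts with the letters of \<open>v\<close>, scaled alternately
  by \<open>u\<close> and \<open>1 / u\<close>, which is how multiplication by a unit acts on partial quotients.\<close>

fun cyl :: "'a::field \<Rightarrow> 'a list \<Rightarrow> 'a fls \<Rightarrow> bool" where
  "cyl u [] z \<longleftrightarrow> ub (-1) z"
| "cyl u (k # v) z \<longleftrightarrow> ub (-1) z \<and> z \<noteq> 0 \<and> cyl (inverse u) v (1 / z - fls_const u * letter k)"

lemma cyl_small: "cyl u v z \<Longrightarrow> ub (-1) z"
  by (cases v) auto

lemma cyl_appendD: "cyl u (v @ w) z \<Longrightarrow> cyl u v z"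
  by (induction v arbitrary: u z) (auto dest: cyl_small)

lemma cyl_ConsE:
  assumes "cyl u (k # v) z"
  obtains r where "z = 1 / (fls_const u * letter k + r)" "cyl (inverse u) v r" "ub (-1) r"
proof
  show "cyl (inverse u) v (1 / z - fls_const u * letter k)" "ub (-1) (1 / z - fls_const u * letter k)"
    using assms by (auto dest: cyl_small)
qed simp

lemma dg_scaled_letter [simp]: "u \<noteq> 0 \<Longrightarrow> dg (fls_const u * letter k) = 1"
  by (simp add: dg_mult)

lemma cyl_cf:
  assumes "cyl u (k # v) (1 / (a + y))" "a \<in> Rset" "1 \<le> dg a" "ub (-1) y"
  shows "a = fls_const u * letter k" "cyl (inverse u) v y"
proof -
  have *: "cyl (inverse u) v (a + y - fls_const u * letter k)"
    using assms(1) by simp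
  then have "ub (-1) (a + y - fls_const u * letter k - y)"
    using assms(4) by (intro ub_diff[OF cyl_small])
  then have "ub (-1) (a - fls_const u * letter k)"
    by simp
  then show "a = fls_const u * letter k"
    using assms(2) by (intro Rset_eqI Rset_mult Rset_const letter_Rset)
  then show "cyl (inverse u) v y"
    using * by simp
qed

lemma cyl_diff:
  assumes "cyl u v z" "cyl u v z'" "u \<noteq> 0"
  shows "ub (- 2 * int (length v) - 1) (z - z')"
  using assms
proof (induction v arbitrary: u z z')
  case Nil
  then show ?case by (auto intro: ub_diff)
next
  case (Cons k v)
  obtain r where r: "z = 1 / (fls_const u * letter k + r)" "cyl (inverse u) v r" "ub (-1) r"
    using Cons.prems(1) by (rule cyl_ConsE)
  obtain r' where r': "z' = 1 / (fls_const u * letter k + r')" "cyl (inverse u) v r'" "ub (-1) r'"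
    using Cons.prems(2) by (rule cyl_ConsE)
  have "ub (- 2 * int (length v) - 1) (r - r')"
    using Cons.IH r r' Cons.prems(3) by simp
  then have "ub (- 2 * int (length v) - 1 - 2 * 1) (z - z')"
    using ub_cf_diff[of "fls_const u * letter k" r r' "- 2 * int (length v) - 1"] r r' Cons.prems(3) by simp
  then show ?case
    by (rule ub_mono) simp
qed

lemma cyl_diff_last:
  assumes "cyl u (v @ [k]) z" "cyl u (v @ [k']) z'" "u \<noteq> 0" "k \<noteq> k'"
  shows "z \<noteq> z' \<and> dg (z - z') = - 2 * int (length v) - 2"
  using assms(1-3)
proof (induction v arbitrary: u z z')
  case Nil
  obtain r where r: "z = 1 / (fls_const u * letter k + r)" "ub (-1) r"
    using Nil.prems(1) cyl_ConsE[of u k "[]" z] by auto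
  obtain r' where r': "z' = 1 / (fls_const u * letter k' + r')" "ub (-1) r'"
    using Nil.prems(2) cyl_ConsE[of u k' "[]" z'] by auto
  define G G' where "G = fls_const u * letter k + r" and "G' = fls_const u * letter k' + r'"
  have G: "G \<noteq> 0" "dg G = 1" "G' \<noteq> 0" "dg G' = 1"
    unfolding G_def G'_def
    using dg_cf_denominator[of "fls_const u * letter k" r] dg_cf_denominator[of "fls_const u * letter k'" r'] r r' Nil.prems(3)
    by simp_all
  have GG: "G' - G = fls_const (u * (k' - k)) + (r' - r)"
    by (simp add: G_def G'_def letter_def algebra_simps flip: fls_const_mult_const fls_minus_const)
  have "fls_const (u * (k' - k)) \<noteq> 0"
    using assms(4) Nil.prems(3) by simp
  then have "G' - G \<noteq> 0" "dg (G' - G) = 0"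
    unfolding GG using dg_add_dominant[of "fls_const (u * (k' - k))" "r' - r"] ub_diff[OF r'(2) r(2)] by auto
  moreover have "z = 1 / G" "z' = 1 / G'"
    using r(1) r'(1) by (simp_all only: G_def G'_def)
  then have "z - z' = (G' - G) / (G * G')"
    using G by (simp add: field_simps)
  ultimately show ?case
    using G by (auto simp: dg_divide dg_mult)
next
  case (Cons m v)
  obtain r where r: "z = 1 / (fls_const u * letter m + r)" "cyl (inverse u) (v @ [k]) r" "ub (-1) r"
    by (rule cyl_ConsE[OF Cons.prems(1)[unfolded append_Cons]])
  obtain r' where r': "z' = 1 / (fls_const u * letter m + r')" "cyl (inverse u) (v @ [k']) r'" "ub (-1) r'"
    by (rule cyl_ConsE[OF Cons.prems(2)[unfolded append_Cons]])
  have IH: "r \<noteq> r'" "dg (r - r') = - 2 * int (length v) - 2"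
    using Cons.IH r r' Cons.prems(3) by auto
  have "ub (n - 2) (z - z') \<longleftrightarrow> ub n (r - r')" for n
    using ub_cf_diff[of "fls_const u * letter m" r r' n] r r' Cons.prems(3) by simp
  from this[of "dg (r - r')"] this[of "dg (r - r') - 1"] IH
  show ?case
    by (auto simp: ub_def)
qed

context quadratic_line
begin

definition word :: "int \<Rightarrow> nat \<Rightarrow> 'a list" where
  "word t n = map (\<lambda>i. c (t + int i)) [0..<n]"

lemma length_word [simp]: "length (word t n) = n"
  by (simp add: word_def)

lemma nth_word [simp]: "i < n \<Longrightarrow> word t n ! i = c (t + int i)"
  by (simp add: word_def)

lemma word_0 [simp]: "word t 0 = []"
  by (simp add: word_def)

lemma word_Suc: "word t (Suc n) = c t # word (t + 1) n"
  by (rule nth_equalityI) (auto simp: nth_Cons ac_simps split: nat.split)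

lemma word_snoc: "word t (Suc n) = word t n @ [c (t + int n)]"
  by (simp add: word_def)

lemma cyl_word: "u \<noteq> 0 \<Longrightarrow> cyl u (word t n) (1 / (fls_const u * A t))"
proof (induction n arbitrary: u t)
  case 0
  then show ?case
    by (simp add: ub_def dg_divide dg_mult)
next
  case (Suc n)
  have "1 / (1 / (fls_const u * A t)) - fls_const u * letter (c t) = fls_const u * (A t - letter (c t))"
    by (simp add: algebra_simps)
  also have "\<dots> = 1 / (fls_const (inverse u) * A (t + 1))"
    using A_step[of t] Suc.prems by (simp add: field_simps flip: fls_const_inverse)
  finally show ?case
    using Suc by (simp add: word_Suc ub_def dg_divide dg_mult)
qed

lemma close_step:
  assumes u: "u \<noteq> 0" and close: "ub (- n - 2) (z - 1 / (fls_const u * A t))" and n: "0 \<le> n"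
  shows "z \<noteq> 0" "ub (-1) z" "ub (- n) (1 / z - fls_const u * A t)"
proof -
  define y where "y = 1 / (fls_const u * A t)"
  have y: "y \<noteq> 0" "dg y = - 1"
    using u by (simp_all add: y_def dg_divide dg_mult)
  have "ub (dg y - 1) (z - y)"
    using close n y unfolding y_def by (auto intro: ub_mono)
  then have z: "z \<noteq> 0" "dg z = - 1"
    using dg_close[OF y(1)] y by auto
  then show "z \<noteq> 0" "ub (-1) z"
    by (auto simp: ub_def)
  have "1 / z - fls_const u * A t = 1 / z - 1 / y"
    by (simp add: y_def)
  also have "\<dots> = (y - z) / (z * y)"
    using y z by (simp add: field_simps)
  finally show "ub (- n) (1 / z - fls_const u * A t)"
    using y z close by (simp add: ub_divide_iff dg_mult ub_minus_commute[of _ y] flip: y_def)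
qed

lemma remainder_eq:
  "u \<noteq> 0 \<Longrightarrow> (G - fls_const u * letter (c t)) - 1 / (fls_const (inverse u) * A (t + 1)) = G - fls_const u * A t"
  using A_step[of t] by (simp add: field_simps flip: fls_const_inverse)

lemma cyl_if_close:
  assumes "u \<noteq> 0" "ub (-1) z" "ub (- 2 * int n - 1) (z - 1 / (fls_const u * A t))"
  shows "cyl u (word t n) z"
  using assms
proof (induction n arbitrary: u t z)
  case 0
  then show ?case by simp
next
  case (Suc n)
  define r where "r = 1 / z - fls_const u * letter (c t)"
  have *: "z \<noteq> 0" "ub (- 2 * int n - 1) (r - 1 / (fls_const (inverse u) * A (t + 1)))"
    using close_step(1,3)[of u "2 * int n + 1" z t] Suc.prems unfolding r_def remainder_eq[OF Suc.prems(1)] by simp_all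
  have "ub (-1) (1 / (fls_const (inverse u) * A (t + 1)))"
    using Suc.prems by (simp add: ub_def dg_divide dg_mult)
  moreover have "ub (-1) (r - 1 / (fls_const (inverse u) * A (t + 1)))"
    using *(2) by (rule ub_mono) simp
  ultimately have "ub (-1) r"
    using ub_add by fastforce
  then have "cyl (inverse u) (word (t + 1) n) r"
    using Suc.IH Suc.prems(1) * by simp
  then show ?case
    using * Suc.prems(2) by (simp add: word_Suc r_def)
qed

text \<open>One power of \<open>q\<close> beyond \<open>n\<close> letters fixes the degree and the
  leading coefficient of the next quotient, so that only its constant term is free.\<close>

lemma cyl_snoc_if_close:
  assumes "u \<noteq> 0" "ub (-1) z" "ub (- 2 * int n - 2) (z - 1 / (fls_const u * A t))"
  shows "\<exists>k. cyl u (word t n @ [k]) z"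
  using assms
proof (induction n arbitrary: u t z)
  case 0
  then have *: "z \<noteq> 0" "ub 0 (1 / z - fls_const u * A t)"
    using close_step[of u 0 z t] by auto
  have "ub 0 (fls_const u * (1 / A (t + 1)))"
    using ub_mult[OF ub_dg A_small, of "fls_const u" "t + 1"] by (auto intro: ub_mono)
  then have "ub 0 ((1 / z - fls_const u * A t) + fls_const u * (1 / A (t + 1)))"
    using * by (intro ub_add)
  moreover have "(1 / z - fls_const u * A t) + fls_const u * (1 / A (t + 1)) = 1 / z - fls_const u * letter (c t)"
    using A_step[of t] by (simp add: algebra_simps)
  ultimately have "ub 0 (1 / z - fls_const u * letter (c t))"
    by metis
  then obtain m where "ub (-1) (1 / z - fls_const u * letter (c t) - fls_const m)"
    using ub_lead by blast
  moreover have "1 / z - fls_const u * letter (c t) - fls_const m = 1 / z - fls_const u * letter (c t + m / u)"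
    using 0 by (simp add: letter_def algebra_simps flip: fls_plus_const)
  ultimately show ?case
    using * 0 by (intro exI[of _ "c t + m / u"]) simp
next
  case (Suc n)
  define r where "r = 1 / z - fls_const u * letter (c t)"
  have *: "z \<noteq> 0" "ub (- 2 * int n - 2) (r - 1 / (fls_const (inverse u) * A (t + 1)))"
    using close_step(1,3)[of u "2 * int n + 2" z t] Suc.prems unfolding r_def remainder_eq[OF Suc.prems(1)] by simp_all
  have "ub (-1) (1 / (fls_const (inverse u) * A (t + 1)))"
    using Suc.prems by (simp add: ub_def dg_divide dg_mult)
  moreover have "ub (-1) (r - 1 / (fls_const (inverse u) * A (t + 1)))"
    using *(2) by (rule ub_mono) simp
  ultimately have "ub (-1) r"
    using ub_add by fastforce
  then obtain k where "cyl (inverse u) (word (t + 1) n @ [k]) r"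
    using Suc.IH Suc.prems(1) * by fastforce
  then show ?case
    using * Suc.prems(2) by (intro exI[of _ k]) (simp add: word_Suc r_def)
qed

text \<open>Turns agreement with the past into agreement with the line read backwards from
  \<open>t\<close>, at the inverse scale; this is why the same word lemmas serve both sides.\<close>

lemma conjugate_past: "u \<noteq> 0 \<Longrightarrow> y + fls_const u * Ac t = y - 1 / (fls_const (inverse u) * A (- t))"
  by (simp add: Ac_def field_simps flip: fls_const_inverse)

section \<open>The liminf in terms of integer exponents\<close>

lemma q_gt_1: "1 < real CARD('a)"
  using card_mono[of "UNIV :: 'a set" "{0, 1}"] by simp

lemma absv_eq: "(y::'a fls) \<noteq> 0 \<Longrightarrow> absv y = real CARD('a) powr real_of_int (dg y)"
  by (simp add: absv_def dg_def)

lemma qpow_less [simp]: "real CARD('a) powr real_of_int m < real CARD('a) powr real_of_int n \<longleftrightarrow> m < n"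
  using q_gt_1 by simp

lemma qpow_le [simp]: "real CARD('a) powr real_of_int m \<le> real CARD('a) powr real_of_int n \<longleftrightarrow> m \<le> n"
  using q_gt_1 by simp

lemma qpow_small:
  assumes "e > 0"
  obtains H where "real CARD('a) powr real_of_int H < e"
proof -
  have "real CARD('a) powr real_of_int (\<lfloor>log (real CARD('a)) e\<rfloor> - 1) < real CARD('a) powr (log (real CARD('a)) e)"
    using q_gt_1 by (subst powr_less_cancel_iff) linarith+
  also have "\<dots> = e"
    using assms q_gt_1 by simp
  finally show ?thesis by (rule that)
qed

lemma eventually_theta_filter:
  "eventually P (theta_filter (A 0)) \<longleftrightarrow> (\<exists>H. \<forall>b b'. (b, b') \<in> TP \<longrightarrow> dg (b - b') \<le> H \<longrightarrow> P b)"
proof -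
  have "eventually P (theta_filter (A 0)) \<longleftrightarrow>
      (\<exists>e\<in>{0<..}. eventually P (principal {\<beta> \<in> Theta (A 0). absv (\<beta> - galconj \<beta>) < e}))"
    unfolding theta_filter_def
  proof (rule eventually_INF_base)
    fix d e :: real
    assume "d \<in> {0<..}" "e \<in> {0<..}"
    then show "\<exists>x\<in>{0<..}. principal {\<beta> \<in> Theta (A 0). absv (\<beta> - galconj \<beta>) < x} \<le>
        inf (principal {\<beta> \<in> Theta (A 0). absv (\<beta> - galconj \<beta>) < d}) (principal {\<beta> \<in> Theta (A 0). absv (\<beta> - galconj \<beta>) < e})"
      by (intro bexI[of _ "min d e"]) auto
  qed auto
  also have "\<dots> \<longleftrightarrow> (\<exists>e>0. \<forall>b b'. (b, b') \<in> TP \<longrightarrow> absv (b - b') < e \<longrightarrow> P b)"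
  proof -
    have "eventually P (principal {\<beta> \<in> Theta (A 0). absv (\<beta> - galconj \<beta>) < e}) \<longleftrightarrow>
        (\<forall>b b'. (b, b') \<in> TP \<longrightarrow> absv (b - b') < e \<longrightarrow> P b)" for e
      unfolding eventually_principal Theta_eq by (force simp: galconj_TP)
    then show ?thesis
      by auto
  qed
  also have "\<dots> \<longleftrightarrow> (\<exists>H. \<forall>b b'. (b, b') \<in> TP \<longrightarrow> dg (b - b') \<le> H \<longrightarrow> P b)"
  proof (safe)
    fix e :: real
    assume "e > 0" and *: "\<forall>b b'. (b, b') \<in> TP \<longrightarrow> absv (b - b') < e \<longrightarrow> P b"
    obtain H where H: "real CARD('a) powr real_of_int H < e"
      using qpow_small[OF \<open>e > 0\<close>] .
    show "\<exists>H. \<forall>b b'. (b, b') \<in> TP \<longrightarrow> dg (b - b') \<le> H \<longrightarrow> P b"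
    proof (intro exI[of _ H] allI impI)
      fix b b'
      assume b: "(b, b') \<in> TP" "dg (b - b') \<le> H"
      then have "absv (b - b') \<le> real CARD('a) powr real_of_int H"
        using TP_irrational(3) by (simp add: absv_eq)
      then show "P b"
        using * b H by force
    qed
  next
    fix H
    assume *: "\<forall>b b'. (b, b') \<in> TP \<longrightarrow> dg (b - b') \<le> H \<longrightarrow> P b"
    show "\<exists>e>0. \<forall>b b'. (b, b') \<in> TP \<longrightarrow> absv (b - b') < e \<longrightarrow> P b"
    proof (intro exI[of _ "real CARD('a) powr real_of_int (H + 1)"] conjI allI impI)
      show "0 < real CARD('a) powr real_of_int (H + 1)"
        using q_gt_1 by simp
      fix b b'
      assume b: "(b, b') \<in> TP" "absv (b - b') < real CARD('a) powr real_of_int (H + 1)"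
      then have "dg (b - b') < H + 1"
        using TP_irrational(3) qpow_less by (simp add: absv_eq del: of_int_add)
      then show "P b"
        using * b by force
    qed
  qed
  finally show ?thesis .
qed

text \<open>The length of the common part of the geodesic from \<open>\<infinity>\<close> to \<open>f\<close> and the geodesic
  between \<open>b\<close> and \<open>b'\<close> in the Bruhat--Tits tree, when it is positive.\<close>

definition gain :: "'a fls \<Rightarrow> 'a fls \<Rightarrow> 'a fls \<Rightarrow> int" where
  "gain f b b' = dg (b - b') - dg (f - b)"

lemma ratio_eq:
  assumes "(b, b') \<in> TP" "f \<notin> Theta (A 0)"
  shows "absv (f - b) / absv (b - galconj b) = real CARD('a) powr real_of_int (- gain f b b')"
proof -
  have "f \<noteq> b" "b \<noteq> b'"
    using assms Theta_eq TP_irrational(3) by force+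
  then show ?thesis
    using galconj_TP[OF assms(1)] by (simp add: absv_eq gain_def flip: powr_diff)
qed

lemma c_alpha_le:
  assumes f: "f \<notin> Theta (A 0)"
    and often: "\<And>H. \<exists>b b'. (b, b') \<in> TP \<and> dg (b - b') \<le> H \<and> N \<le> gain f b b'"
  shows "c_alpha (A 0) f \<le> ereal (real CARD('a) powr real_of_int (- N))"
proof (rule ccontr)
  assume "\<not> ?thesis"
  then have "eventually (\<lambda>\<beta>. ereal (real CARD('a) powr real_of_int (- N)) < ereal (absv (f - \<beta>) / absv (\<beta> - galconj \<beta>))) (theta_filter (A 0))"
    unfolding c_alpha_def by (intro less_LiminfD) simp
  then obtain H where H: "\<And>b b'. (b, b') \<in> TP \<Longrightarrow> dg (b - b') \<le> H \<Longrightarrow>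
      ereal (real CARD('a) powr real_of_int (- N)) < ereal (absv (f - b) / absv (b - galconj b))"
    unfolding eventually_theta_filter by blast
  obtain b b' where b: "(b, b') \<in> TP" "dg (b - b') \<le> H" "N \<le> gain f b b'"
    using often by blast
  have "real CARD('a) powr real_of_int (- N) < real CARD('a) powr real_of_int (- gain f b b')"
    using H[OF b(1,2)] unfolding ratio_eq[OF b(1) f] by simp
  then have "- N < - gain f b b'"
    unfolding qpow_less .
  then show False
    using b(3) by simp
qed

lemma c_alpha_ge:
  assumes f: "f \<notin> Theta (A 0)"
    and ev: "\<And>b b'. (b, b') \<in> TP \<Longrightarrow> dg (b - b') \<le> H \<Longrightarrow> gain f b b' \<le> N"
  shows "ereal (real CARD('a) powr real_of_int (- N)) \<le> c_alpha (A 0) f"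
  unfolding c_alpha_def
proof (rule Liminf_bounded, unfold eventually_theta_filter, intro exI[of _ H] allI impI)
  fix b b'
  assume b: "(b, b') \<in> TP" "dg (b - b') \<le> H"
  show "ereal (real CARD('a) powr real_of_int (- N)) \<le> ereal (absv (f - b) / absv (b - galconj b))"
    unfolding ratio_eq[OF b(1) f] ereal_less_eq qpow_le using ev[OF b] by simp
qed

text \<open>The liminf exceeds the next smaller power of \<open>q\<close>, so the ratios eventually
  exceed that power too, and integrality of \<open>gain\<close> gives the bound
  \<open>N\<close>.\<close>

lemma c_alpha_eventually:
  assumes f: "f \<notin> Theta (A 0)" and eq: "c_alpha (A 0) f = ereal (real CARD('a) powr real_of_int (- N))"
  obtains H where "\<And>b b'. (b, b') \<in> TP \<Longrightarrow> dg (b - b') \<le> H \<Longrightarrow> gain f b b' \<le> N"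
proof -
  have "ereal (real CARD('a) powr real_of_int (- (N + 1))) < c_alpha (A 0) f"
    unfolding eq less_ereal.simps qpow_less by simp
  then have "eventually (\<lambda>\<beta>. ereal (real CARD('a) powr real_of_int (- (N + 1))) < ereal (absv (f - \<beta>) / absv (\<beta> - galconj \<beta>))) (theta_filter (A 0))"
    unfolding c_alpha_def by (rule less_LiminfD)
  then obtain H where H: "\<And>b b'. (b, b') \<in> TP \<Longrightarrow> dg (b - b') \<le> H \<Longrightarrow>
      ereal (real CARD('a) powr real_of_int (- (N + 1))) < ereal (absv (f - b) / absv (b - galconj b))"
    unfolding eventually_theta_filter by blast
  have "gain f b b' \<le> N" if b: "(b, b') \<in> TP" "dg (b - b') \<le> H" for b b'
  proof -
    have "- (N + 1) < - gain f b b'"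
      using H[OF b] unfolding ratio_eq[OF b(1) f] less_ereal.simps qpow_less .
    then show ?thesis by simp
  qed
  then show ?thesis by (rule that)
qed

lemma c_alpha_frequently:
  assumes f: "f \<notin> Theta (A 0)" and eq: "c_alpha (A 0) f = ereal (real CARD('a) powr real_of_int (- N))"
  obtains b b' where "(b, b') \<in> TP" "dg (b - b') \<le> H" "N \<le> gain f b b'"
proof (rule ccontr)
  assume *: "\<not> thesis"
  have "gain f b b' \<le> N - 1" if "(b, b') \<in> TP" "dg (b - b') \<le> H" for b b'
    using that * \<open>\<And>b b'. (b, b') \<in> TP \<Longrightarrow> dg (b - b') \<le> H \<Longrightarrow> N \<le> gain f b b' \<Longrightarrow> thesis\<close> by force
  then have "ereal (real CARD('a) powr real_of_int (- (N - 1))) \<le> c_alpha (A 0) f"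
    using c_alpha_ge[OF f] by blast
  then show False
    unfolding eq ereal_less_eq qpow_le by simp
qed

end

text \<open>In \<open>rich\<close> the contexts differ only two places before the word: the
  occurrences that the construction supplies are all preceded by one of the letters 1 inserted for
  \<open>sparse\<close>.\<close>

locale rich_line = quadratic_line c p A
  for c :: "int \<Rightarrow> 'a::{field,finite}" and p A +
  fixes l :: nat
  assumes sparse: "\<And>t. \<exists>i\<le>l. c (t + int i) \<noteq> 0"
    and rich: "\<And>v. length v \<le> l \<Longrightarrow> \<exists>t t'. map (\<lambda>i. c (t + int i)) [0..<length v] = v \<and>
      map (\<lambda>i. c (t' + int i)) [0..<length v] = v \<and> c (t - 1) = c (t' - 1) \<and> c (t - 2) \<noteq> c (t' - 2)"

section \<open>Overlaps with an arbitrary series\<close>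

locale rich_approximation = rich_line c p A l + approximation c p A f e a x
  for c :: "int \<Rightarrow> 'a::{field,finite}" and p A l f e a x +
  assumes f_Theta: "f \<notin> Theta (A 0)"
begin

lemma f_neq: "(b, b') \<in> TP \<Longrightarrow> f \<noteq> b" "(b, b') \<in> TP \<Longrightarrow> f \<noteq> b'"
  using f_Theta TP_swap unfolding Theta_eq by force+

lemma gain_reduced:
  assumes "(b, b') \<in> TP" "u \<noteq> 0" "tail n b = fls_const u * A t" "tail n b' = fls_const u * Ac t"
  shows "gain f b b' = - dg (x n - 1 / (fls_const u * A t)) - dg (past n - 1 / (fls_const (inverse u) * A (- t)))"
    and "dg (b - b') = - scale n - dg (past n - 1 / (fls_const (inverse u) * A (- t)))"
    and "x n \<noteq> 1 / (fls_const u * A t)" "past n \<noteq> 1 / (fls_const (inverse u) * A (- t))"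
  using reduced_tail[OF assms(1) f_neq(1)[OF assms(1)] assms(2-4)]
  unfolding conjugate_past[OF assms(2)] gain_def by auto

lemma gain_reducedE:
  assumes "(b, b') \<in> TP" "3 \<le> gain f b b'"
  obtains n u t i j where "u \<noteq> 0" "gain f b b' = int i + int j" "dg (b - b') = int j - scale n" "1 \<le> i" "1 \<le> j"
    "ub (- int i) (x n - 1 / (fls_const u * A t))" "ub (- int j) (past n - 1 / (fls_const (inverse u) * A (- t)))"
proof -
  obtain n where n: "1 \<le> dg (tail n b)" "ub (-1) (tail n b')"
    using reduced_tail_exists[OF assms(1) f_neq[OF assms(1)]] assms(2) by (auto simp: gain_def)
  obtain t u where u: "u \<noteq> 0" "tail n b = fls_const u * A t" "tail n b' = fls_const u * Ac t"
    using TP_reduced[OF tail_TP[OF assms(1)] n] .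
  define X Y where "X = x n - 1 / (fls_const u * A t)" and "Y = past n - 1 / (fls_const (inverse u) * A (- t))"
  note g = gain_reduced[OF assms(1) u, folded X_def Y_def]
  have "X \<noteq> 0" "Y \<noteq> 0"
    using g(3,4) by (auto simp: X_def Y_def)
  have small: "ub (-1) (1 / (fls_const v * A s))" if "v \<noteq> 0" for v s
    using that by (simp add: ub_def dg_divide dg_mult)
  have "ub (-1) X" "ub (-1) Y"
    unfolding X_def Y_def using u(1) by (auto intro!: ub_diff x_small past_small small)
  then have "dg X \<le> - 1" "dg Y \<le> - 1"
    using \<open>X \<noteq> 0\<close> \<open>Y \<noteq> 0\<close> by (auto simp: ub_def)
  then show ?thesis
    using that[of u "nat (- dg X)" "nat (- dg Y)" n t] u g(1,2) by (simp add: X_def[symmetric] Y_def[symmetric])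
qed

lemma gain_word:
  assumes "(b, b') \<in> TP" "tail n b = A T" "tail n b' = Ac T"
  shows "gain f b b' = - dg (x n - 1 / A T) - dg (past n - 1 / A (- T))"
    "dg (b - b') = - scale n - dg (past n - 1 / A (- T))"
    "x n \<noteq> 1 / A T" "past n \<noteq> 1 / A (- T)"
  using gain_reduced[OF assms(1), of 1 n T] assms(2,3) by auto

text \<open>Two occurrences of the word whose left contexts differ cannot both follow \<open>f\<close> far into
  the past, so one of them yields a conjugate pair at small distance.\<close>

lemma translate_along_word:
  assumes u: "u \<noteq> 0" and cyl: "cyl u vr (x n)" "cyl (inverse u) vl (past n)"
    and len: "length vl + length vr \<le> l"
  shows "\<exists>b b'. (b, b') \<in> TP \<and> dg (b - b') \<le> 2 * int l + 4 - scale n \<and>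
    2 * int (length vl + length vr) + 2 \<le> gain f b b'"
proof -
  define L where "L = length vl"
  obtain t t' where t: "word t (length (rev vl @ vr)) = rev vl @ vr" "word t' (length (rev vl @ vr)) = rev vl @ vr"
    "c (t - 1) = c (t' - 1)" "c (t - 2) \<noteq> c (t' - 2)"
    using rich[of "rev vl @ vr"] len by (auto simp: word_def)
  \<comment> \<open>By palindromicity, reading backwards from the split point
    \<open>s + int L\<close> is reading forwards from its negative; the past side shows
    \<open>vl\<close> and then the two context letters.\<close>
  have right: "word (s + int L) (length vr) = vr" and left: "word (- (s + int L)) (L + 2) = (vl @ [c (s - 1)]) @ [c (s - 2)]"
    if s: "word s (length (rev vl @ vr)) = rev vl @ vr" for s
  proof -
    have c: "c (s + int i) = (rev vl @ vr) ! i" if "i < L + length vr" for i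
    proof -
      have "c (s + int i) = word s (length (rev vl @ vr)) ! i"
        using that by (simp add: L_def)
      then show ?thesis
        unfolding s .
    qed
    show "word (s + int L) (length vr) = vr"
      using c[of "L + i" for i] by (intro nth_equalityI) (auto simp: L_def nth_append ac_simps)
    have "c (- (s + int L) + int i) = vl ! i" if "i < L" for i
    proof -
      have "c (- (s + int L) + int i) = c (s + int (L - 1 - i))"
        using that palindromic[of "s + int (L - 1 - i)"] by (simp add: of_nat_diff algebra_simps)
      also have "\<dots> = vl ! i"
      proof -
        have "L - 1 - i < length (rev vl)" "length vl - Suc (L - 1 - i) = i"
          using that by (auto simp: L_def)
        then show ?thesis
          using c[of "L - 1 - i"] by (auto simp: nth_append rev_nth L_def)
      qed
      finally show ?thesis .
    qed
    then have "word (- (s + int L)) L = vl"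
      by (intro nth_equalityI) (auto simp: L_def)
    moreover have "c (- (s + int L) + int L) = c (s - 1)"
      using palindromic[of "s - 1"] by simp
    moreover have "c (- (s + int L) + int (Suc L)) = c (s - 2)"
      using palindromic[of "s - 2"] by simp
    ultimately show "word (- (s + int L)) (L + 2) = (vl @ [c (s - 1)]) @ [c (s - 2)]"
      using word_snoc[of "- (s + int L)" L] word_snoc[of "- (s + int L)" "Suc L"] by simp
  qed
  define u' where "u' = inverse u"
  have u': "u' \<noteq> 0"
    using u by (simp add: u'_def)
  define y where "y s = 1 / (fls_const u' * A (- (s + int L)))" for s
  have y: "cyl u' ((vl @ [c (s - 1)]) @ [c (s - 2)]) (y s)"
    if "word s (length (rev vl @ vr)) = rev vl @ vr" for s
    using cyl_word[OF u', of "- (s + int L)" "L + 2"] left[OF that] by (simp add: y_def)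
  \<comment> \<open>The two candidates share \<open>vl\<close> and one context letter,
    \<open>L + 1\<close> letters in all, before they differ; by the ultrametric inequality
    \<open>past n\<close> cannot be closer to both than they are to each other.\<close>
  have yt: "y t \<noteq> y t'" "dg (y t - y t') = - 2 * int L - 4"
    using cyl_diff_last[OF y[OF t(1)] y[OF t(2), folded t(3)] u' t(4)] by (auto simp: L_def)
  have "\<not> (ub (- 2 * int L - 5) (past n - y t) \<and> ub (- 2 * int L - 5) (past n - y t'))"
  proof
    assume "ub (- 2 * int L - 5) (past n - y t) \<and> ub (- 2 * int L - 5) (past n - y t')"
    then have "ub (- 2 * int L - 5) ((past n - y t') - (past n - y t))"
      using ub_diff by blast
    then show False
      using yt by (auto simp: ub_def)
  qed
  then obtain s where s: "word s (length (rev vl @ vr)) = rev vl @ vr" "\<not> ub (- 2 * int L - 5) (past n - y s)"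
    using t(1,2) by blast
  define T where "T = s + int L"
  obtain b b' where b: "(b, b') \<in> TP" "tail n b = fls_const u * A T" "tail n b' = fls_const u * Ac T"
    using tail_TP_surj[OF TP_reduced_I[OF u]] .
  note g = gain_reduced[OF b(1) u b(2,3), folded u'_def]
  have ys: "y s = 1 / (fls_const u' * A (- T))"
    by (simp add: y_def T_def)
  have "- 2 * int L - 4 \<le> dg (past n - y s)"
    using s(2) by (auto simp: not_ub)
  moreover have "cyl u' vl (y s)"
    using y[OF s(1)] cyl_appendD by auto
  then have "dg (past n - y s) \<le> - 2 * int L - 1"
    using cyl_diff[OF cyl(2)[folded u'_def] _ u', of "y s"] g(4) unfolding ys by (auto simp: ub_def L_def)
  moreover have "cyl u vr (1 / (fls_const u * A T))"
    using cyl_word[OF u, of T "length vr"] right[OF s(1)] by (simp add: T_def)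
  then have "dg (x n - 1 / (fls_const u * A T)) \<le> - 2 * int (length vr) - 1"
    using cyl_diff[OF cyl(1) _ u] g(3) by (auto simp: ub_def)
  ultimately show ?thesis
    using g(1,2) b(1) len by (intro exI[of _ b] exI[of _ b']) (auto simp: ys L_def)
qed

text \<open>The empty word can be read at every place \<open>n\<close>, and the pairs obtained
  shrink because \<open>scale n\<close> grows.\<close>

lemma c_alpha_le_2: "c_alpha (A 0) f \<le> ereal (real CARD('a) powr real_of_int (- 2))"
proof (rule c_alpha_le[OF f_Theta])
  fix H
  define n where "n = nat (2 * int l + 4 - H)"
  obtain b b' where "(b, b') \<in> TP" "dg (b - b') \<le> 2 * int l + 4 - scale n" "2 \<le> gain f b b'"
    using translate_along_word[of 1 "[]" n "[]"] x_small past_small by auto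
  moreover have "2 * int l + 4 - H \<le> int n"
    by (simp add: n_def)
  then have "2 * int l + 4 - scale n \<le> H"
    using scale_ge[of n] by linarith
  ultimately show "\<exists>b b'. (b, b') \<in> TP \<and> dg (b - b') \<le> H \<and> 2 \<le> gain f b b'"
    by force
qed

text \<open>As \<open>i + j\<close> is odd, one of the two agreements is even, and that one shows an
  additional letter of \<open>f\<close>. The letters on both sides form a word of length
  \<open>k\<close>, at which \<open>translate_along_word\<close> finds overlap at least
  \<open>2 * k + 2\<close>.\<close>

lemma c_alpha_neq_short_odd:
  assumes k: "1 \<le> k" "k \<le> l"
  shows "c_alpha (A 0) f \<noteq> ereal (real CARD('a) powr real_of_int (- (2 * int k + 1)))"
proof
  assume eq: "c_alpha (A 0) f = ereal (real CARD('a) powr real_of_int (- (2 * int k + 1)))"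
  obtain H where H: "\<And>b b'. (b, b') \<in> TP \<Longrightarrow> dg (b - b') \<le> H \<Longrightarrow> gain f b b' \<le> 2 * int k + 1"
    by (rule c_alpha_eventually[OF f_Theta eq]) blast
  \<comment> \<open>The margin \<open>2 * int l + 4\<close> is the loss of distance in
    \<open>translate_along_word\<close>, whose pair must still lie below the threshold
    \<open>H\<close>.\<close>
  obtain b b' where b: "(b, b') \<in> TP" "dg (b - b') \<le> H - 2 * int l - 4" "2 * int k + 1 \<le> gain f b b'"
    by (rule c_alpha_frequently[OF f_Theta eq])
  have gain: "gain f b b' = 2 * int k + 1"
    using H[OF b(1)] b(2,3) by force
  have "3 \<le> gain f b b'"
    using gain k by simp
  from gain_reducedE[OF b(1) this]
  obtain n u t i j where *: "u \<noteq> 0" "gain f b b' = int i + int j" "dg (b - b') = int j - scale n"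
    "1 \<le> i" "1 \<le> j" "ub (- int i) (x n - 1 / (fls_const u * A t))"
    "ub (- int j) (past n - 1 / (fls_const (inverse u) * A (- t)))" .
  have height: "2 * int l + 4 - scale n \<le> H"
    using b(2) *(3,5) by simp
  have u': "inverse u \<noteq> 0"
    using *(1) by simp
  have sum: "i + j = 2 * k + 1"
    using *(2) gain by simp
  have "\<exists>vl vr. cyl u vr (x n) \<and> cyl (inverse u) vl (past n) \<and> length vl + length vr = k"
  proof (cases "odd i")
    case True
    then obtain i' where i': "i = 2 * i' + 1"
      by (rule oddE)
    then obtain j' where j': "j = 2 * j' + 2" "i' + j' + 1 = k"
      using sum *(5) by (intro that[of "k - i' - 1"]) auto
    have "cyl u (word t i') (x n)"
      using ub_mono[OF *(6), of "- 2 * int i' - 1"] i' by (intro cyl_if_close[OF *(1) x_small]) simp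
    moreover obtain m where "cyl (inverse u) (word (- t) j' @ [m]) (past n)"
      using cyl_snoc_if_close[OF u' past_small, of j' n "- t"] ub_mono[OF *(7), of "- 2 * int j' - 2"] j' by auto
    ultimately show ?thesis
      using j' by (intro exI[of _ "word (- t) j' @ [m]"] exI[of _ "word t i'"]) auto
  next
    case False
    then have "odd j"
      using sum by presburger
    then obtain j' where j': "j = 2 * j' + 1"
      by (rule oddE)
    then obtain i' where i': "i = 2 * i' + 2" "i' + j' + 1 = k"
      using sum *(4) by (intro that[of "k - j' - 1"]) auto
    have "cyl (inverse u) (word (- t) j') (past n)"
      using ub_mono[OF *(7), of "- 2 * int j' - 1"] j' by (intro cyl_if_close[OF u' past_small]) simp
    moreover obtain m where "cyl u (word t i' @ [m]) (x n)"
      using cyl_snoc_if_close[OF *(1) x_small, of i' n t] ub_mono[OF *(6), of "- 2 * int i' - 2"] i' by auto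
    ultimately show ?thesis
      using i' by (intro exI[of _ "word (- t) j'"] exI[of _ "word t i' @ [m]"]) auto
  qed
  then obtain vl vr where v: "cyl u vr (x n)" "cyl (inverse u) vl (past n)" "length vl + length vr = k"
    by blast
  obtain d d' where "(d, d') \<in> TP" "dg (d - d') \<le> 2 * int l + 4 - scale n" "2 * int k + 2 \<le> gain f d d'"
    using translate_along_word[OF *(1) v(1,2)] v(3) k by auto
  then show False
    using H[of d d'] height by simp
qed

end

section \<open>The spectrum\<close>

locale block_approximation = rich_line c p A l + approximation c p A f e a x
  for c :: "int \<Rightarrow> 'a::{field,finite}" and p A l f e a x +
  fixes w :: "'a list"
  assumes a_eq: "\<And>n. a n = (if n mod Suc (length w) = length w then fls_X_inv ^ 2 else letter (w ! (n mod Suc (length w))))"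
begin

abbreviation k where "k \<equiv> length w"

lemma dg_a_separator: "n mod Suc k = k \<Longrightarrow> dg (a n) = 2"
  by (simp add: a_eq dg_power)

text \<open>The conjugate of a member of the orbit would eventually have small tails, making the
  pair of tails reduced with exponent 1 on the side of \<open>f\<close>; at the separators that
  exponent is 2.\<close>

lemma f_notin_Theta: "f \<notin> Theta (A 0)"
proof
  assume "f \<in> Theta (A 0)"
  then obtain y where y: "(f, y) \<in> TP"
    by (auto simp: Theta_eq)
  obtain N where N: "\<And>n. N \<le> n \<Longrightarrow> ub (-1) (tail n y)"
    using tail_eventually_small TP_irrational(2,3)[OF y] by metis
  define n where "n = Suc k * N + k"
  have "N \<le> n"
    by (simp add: n_def)
  have "n mod Suc k = k"
    unfolding n_def by (metis lessI mod_less mod_mult_self4)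
  then have F: "dg (tail n f) = 2"
    by (simp add: tail_f dg_divide dg_x dg_a_separator)
  then have "1 \<le> dg (tail n f)"
    by simp
  from TP_reduced[OF tail_TP[OF y] this N[OF \<open>N \<le> n\<close>]]
  obtain t u where "u \<noteq> 0" "tail n f = fls_const u * A t"
    by blast
  then show False
    using F by (simp add: dg_mult)
qed

sublocale rich_approximation c p A l f e a x
  by unfold_locales (rule f_notin_Theta)

text \<open>All quotients of \<open>f\<close> are monic: the leading coefficient gives
  \<open>v = 1\<close>, and then the constant term determines the letter.\<close>

lemma a_eq_scaled_letter:
  assumes "a n = fls_const v * letter m"
  shows "n mod Suc k < k" "w ! (n mod Suc k) = m"
proof -
  have "v \<noteq> 0"
    using assms a_nonzero[of n] by auto
  then have "n mod Suc k \<noteq> k"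
    using assms dg_a_separator[of n] by (auto simp: dg_mult)
  then show "n mod Suc k < k"
    using mod_less_divisor[of "Suc k" n] by linarith
  have eq: "letter (w ! (n mod Suc k)) = fls_const v * letter m"
    using assms \<open>n mod Suc k \<noteq> k\<close> by (simp add: a_eq)
  have "v = 1"
    using arg_cong[OF eq, of "\<lambda>y. y $$ (- 1)"] by (simp add: letter_def)
  then show "w ! (n mod Suc k) = m"
    using arg_cong[OF eq, of "\<lambda>y. y $$ 0"] by (simp add: letter_def)
qed

lemma cyl_future:
  "cyl u v (x n) \<Longrightarrow> i < length v \<Longrightarrow> \<exists>s. a (n + i) = fls_const s * letter (v ! i)"
proof (induction v arbitrary: u n i)
  case (Cons m v)
  have "cyl u (m # v) (1 / (a n + x (Suc n)))"
    using Cons.prems(1) x_step[of n] by simp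
  note * = cyl_cf[OF this a_Rset a_dg x_small]
  show ?case
    using Cons.IH[OF *(2), of "i - 1"] *(1) Cons.prems(2) by (cases i) auto
qed simp

lemma cyl_past:
  "cyl u v (past n) \<Longrightarrow> i < length v \<Longrightarrow> i < n \<and> (\<exists>s. a (n - Suc i) = fls_const s * letter (v ! i))"
proof (induction v arbitrary: u n i)
  case (Cons m v)
  then obtain n' where n: "n = Suc n'"
    by (cases n) auto
  have "cyl u (m # v) (1 / (a n' + past n'))"
    using Cons.prems(1) by (simp add: n)
  note * = cyl_cf[OF this a_Rset a_dg past_small]
  show ?case
    using Cons.IH[OF *(2), of "i - 1"] *(1) Cons.prems(2) by (cases i) (auto simp: n)
qed simp

lemma mod_future: "n mod Suc k + i \<le> k \<Longrightarrow> (n + i) mod Suc k = n mod Suc k + i"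
  by (metis le_imp_less_Suc mod_add_left_eq mod_less)

lemma mod_past: "i < n mod Suc k \<Longrightarrow> (n - Suc i) mod Suc k = n mod Suc k - Suc i"
proof -
  assume i: "i < n mod Suc k"
  then have "n - Suc i = n div Suc k * Suc k + (n mod Suc k - Suc i)"
    using div_mult_mod_eq[of n "Suc k"] by linarith
  then have "(n - Suc i) mod Suc k = (n mod Suc k - Suc i) mod Suc k"
    by (metis mod_mult_self3)
  also have "\<dots> = n mod Suc k - Suc i"
    using mod_less_divisor[of "Suc k" n] by (intro mod_less) linarith
  finally show ?thesis .
qed

lemma mod_past_separator:
  assumes "n mod Suc k < n"
  shows "(n - Suc (n mod Suc k)) mod Suc k = k"
proof -
  obtain d where d: "n div Suc k = Suc d"
    using assms by (cases "n div Suc k") (auto simp: div_eq_0_iff)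
  have "n - Suc (n mod Suc k) = d * Suc k + k"
    using div_mult_mod_eq[of n "Suc k"] unfolding d by simp
  then show ?thesis
    by (metis lessI mod_less mod_mult_self3)
qed

lemma cyl_future_length: "cyl u v (x n) \<Longrightarrow> length v \<le> k - n mod Suc k"
proof (rule ccontr)
  assume v: "cyl u v (x n)" "\<not> length v \<le> k - n mod Suc k"
  have "n mod Suc k \<le> k"
    using mod_less_divisor[of "Suc k" n] by linarith
  then have "(n + (k - n mod Suc k)) mod Suc k = k"
    using mod_future[of n "k - n mod Suc k"] by simp
  then show False
    using cyl_future[OF v(1), of "k - n mod Suc k"] v(2) a_eq_scaled_letter(1)[of "n + (k - n mod Suc k)"] by auto
qed

lemma cyl_past_length: "cyl u v (past n) \<Longrightarrow> length v \<le> n mod Suc k"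
proof (rule ccontr)
  assume v: "cyl u v (past n)" "\<not> length v \<le> n mod Suc k"
  then obtain s where "n mod Suc k < n" "a (n - Suc (n mod Suc k)) = fls_const s * letter (v ! (n mod Suc k))"
    using cyl_past[OF v(1), of "n mod Suc k"] by auto
  then show False
    using a_eq_scaled_letter(1)[of "n - Suc (n mod Suc k)"] mod_past_separator[of n] by auto
qed

text \<open>At place \<open>n\<close>, \<open>r\<close> letters of the current block lie in the past
  and \<open>k - r\<close> in the future, and a separator stops each agreement. The bounds
  \<open>2 * r + 1\<close> and \<open>2 * (k - r) + 1\<close> add up to \<open>2 * k + 2\<close>,
  and equality means that the whole of \<open>w\<close> is read on the line.\<close>

lemma gain_le:
  assumes "(b, b') \<in> TP"
  shows "gain f b b' \<le> 2 * int k + 2"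
    and "gain f b b' = 2 * int k + 2 \<Longrightarrow> \<exists>t. word t k = w"
proof -
  have "gain f b b' \<le> 2 * int k + 2 \<and> (gain f b b' = 2 * int k + 2 \<longrightarrow> (\<exists>t. word t k = w))"
  proof (cases "3 \<le> gain f b b'")
    case False
    then show ?thesis
    \<comment> \<open>Overlap 2 attains the bound only for the empty word, which is trivially a
      factor.\<close>
    proof (cases "k = 0")
      case True
      then show ?thesis
        using False by auto
    next
      case k: False
      then have "1 \<le> int k"
        by (cases k) auto
      then show ?thesis
        using False by linarith
    qed
  next
    case True
    obtain n u t i j where *: "u \<noteq> 0" "gain f b b' = int i + int j" "dg (b - b') = int j - scale n"
      "1 \<le> i" "1 \<le> j" "ub (- int i) (x n - 1 / (fls_const u * A t))"
      "ub (- int j) (past n - 1 / (fls_const (inverse u) * A (- t)))"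
      using gain_reducedE[OF assms True] .
    have u': "inverse u \<noteq> 0"
      using *(1) by simp
    define r where "r = n mod Suc k"
    have r: "r \<le> k"
      unfolding r_def using mod_less_divisor[of "Suc k" n] by linarith
    have i: "i \<le> 2 * (k - r) + 1"
    proof (rule ccontr)
      assume "\<not> i \<le> 2 * (k - r) + 1"
      then have "ub (- 2 * int (k - r) - 2) (x n - 1 / (fls_const u * A t))"
        by (intro ub_mono[OF *(6)]) linarith
      then obtain m where "cyl u (word t (k - r) @ [m]) (x n)"
        using cyl_snoc_if_close[OF *(1) x_small] by blast
      then show False
        using cyl_future_length r_def by fastforce
    qed
    have j: "j \<le> 2 * r + 1"
    proof (rule ccontr)
      assume "\<not> j \<le> 2 * r + 1"
      then have "ub (- 2 * int r - 2) (past n - 1 / (fls_const (inverse u) * A (- t)))"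
        by (intro ub_mono[OF *(7)]) linarith
      then obtain m where "cyl (inverse u) (word (- t) r @ [m]) (past n)"
        using cyl_snoc_if_close[OF u' past_small] by blast
      then show False
        using cyl_past_length r_def by fastforce
    qed
    have "word (t - int r) k = w" if "gain f b b' = 2 * int k + 2"
    proof -
      have ij: "i = 2 * (k - r) + 1" "j = 2 * r + 1"
        using i j r that *(2) by linarith+
      have right: "cyl u (word t (k - r)) (x n)"
        using *(6) ij(1) by (intro cyl_if_close[OF *(1) x_small]) (auto elim: ub_mono)
      have left: "cyl (inverse u) (word (- t) r) (past n)"
        using *(7) ij(2) by (intro cyl_if_close[OF u' past_small]) (auto elim: ub_mono)
      show ?thesis
      proof (rule nth_equalityI)
        fix i'
        assume "i' < length (word (t - int r) k)"
        then have i': "i' < k" by simp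
        show "word (t - int r) k ! i' = w ! i'"
        proof (cases "i' < r")
          case False
          define d where "d = i' - r"
          have d: "i' = r + d" "d < k - r"
            using False i' by (auto simp: d_def)
          then obtain s where s: "a (n + d) = fls_const s * letter (word t (k - r) ! d)"
            using cyl_future[OF right] by auto
          have "(n + d) mod Suc k = i'"
            using mod_future[of n d] d r by (simp add: r_def)
          then show ?thesis
            using a_eq_scaled_letter(2)[OF s] d i' by (simp add: algebra_simps)
        next
          case True
          define d where "d = r - Suc i'"
          have d: "i' = r - Suc d" "d < r"
            using True by (auto simp: d_def)
          then obtain s where s: "a (n - Suc d) = fls_const s * letter (word (- t) r ! d)"
            using cyl_past[OF left, of d] by auto
          have "(n - Suc d) mod Suc k = i'"
            using mod_past[of d n] d by (simp add: r_def)
          moreover have "c (- t + int d) = c (t - int r + int i')"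
            using palindromic[of "t - int r + int i'"] d by (simp add: of_nat_diff algebra_simps)
          ultimately show ?thesis
            using a_eq_scaled_letter(2)[OF s] d i' by simp
        qed
      qed simp
    qed
    then show ?thesis
      using i j r *(2) by auto
  qed
  then show "gain f b b' \<le> 2 * int k + 2"
    and "gain f b b' = 2 * int k + 2 \<Longrightarrow> \<exists>t. word t k = w"
    by auto
qed

lemma cyl_block_start:
  assumes "n mod Suc k = 0"
  shows "cyl 1 w (x n)"
proof -
  have "cyl 1 v (x m)" if "\<And>i. i < length v \<Longrightarrow> a (m + i) = letter (v ! i)" for m v
    using that
  proof (induction v arbitrary: m)
    case (Cons y v)
    have "a m = letter y"
      using Cons.prems[of 0] by simp
    then have "1 / x m - letter y = x (Suc m)"
      using inverse_x[of m] by simp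
    moreover have "cyl 1 v (x (Suc m))"
      using Cons.prems[of "Suc i" for i] by (intro Cons.IH) auto
    ultimately show ?case
      by (simp add: x_small)
  qed (simp add: x_small)
  moreover have "a (n + i) = letter (w ! i)" if "i < k" for i
    using mod_future[of n i] assms that by (simp add: a_eq)
  ultimately show ?thesis by blast
qed

text \<open>At the start of a block, the separator behind it (or the start of the expansion) leaves
  agreement exactly 1 with the past. So the distance tends to 0 with growing \<open>n\<close>, and
  the future has to supply only \<open>N - 1\<close>.\<close>

lemma gain_often:
  assumes close: "\<And>n. n mod Suc k = 0 \<Longrightarrow> ub (- N + 1) (x n - 1 / A t)"
  shows "\<exists>b b'. (b, b') \<in> TP \<and> dg (b - b') \<le> H \<and> N \<le> gain f b b'"
proof -
  define n where "n = Suc k * nat (1 - H)"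
  have n: "n mod Suc k = 0"
    unfolding n_def by (rule mod_mult_self1_is_0)
  obtain b b' where b: "(b, b') \<in> TP" "tail n b = A t" "tail n b' = Ac t"
    using tail_TP_surj[OF TP_A] .
  note g = gain_word[OF b]
  have small: "ub (-1) (1 / A (- t))"
    by (rule A_small)
  have "\<not> ub (-2) (past n - 1 / A (- t))"
  proof
    assume "ub (-2) (past n - 1 / A (- t))"
    then obtain m where "cyl 1 (word (- t) 0 @ [m]) (past n)"
      using cyl_snoc_if_close[of 1 "past n" 0 "- t"] past_small by auto
    then show False
      using cyl_past_length[of 1 "[m]" n] n by simp
  qed
  then have "- 2 < dg (past n - 1 / A (- t))"
    by (simp add: not_ub)
  moreover have "dg (past n - 1 / A (- t)) \<le> - 1"
    using ub_diff[OF past_small A_small] g(4) by (intro ub_dgD) auto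
  moreover have "dg (x n - 1 / A t) \<le> - N + 1"
    using close[OF n] g(3) by (intro ub_dgD) auto
  moreover have "1 - H \<le> scale n"
  proof -
    have "nat (1 - H) \<le> n"
      by (simp add: n_def)
    then show ?thesis
      using scale_ge[of n] by linarith
  qed
  ultimately show ?thesis
    using g(1,2) b(1) by (intro exI[of _ b] exI[of _ b']) auto
qed

lemma c_alpha_word:
  assumes "w = word t k"
  shows "c_alpha (A 0) f = ereal (real CARD('a) powr real_of_int (- (2 * int k + 2)))"
proof (rule antisym)
  have "ub (- (2 * int k + 2) + 1) (x n - 1 / A t)" if "n mod Suc k = 0" for n
  proof -
    have "ub (- 2 * int k - 1) (x n - 1 / A t)"
      using cyl_diff[OF cyl_block_start[OF that], of "1 / A t"] cyl_word[of 1 t k] assms by simp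
    then show ?thesis
      by (rule ub_mono) simp
  qed
  then show "c_alpha (A 0) f \<le> ereal (real CARD('a) powr real_of_int (- (2 * int k + 2)))"
    by (intro c_alpha_le f_Theta gain_often)
  show "ereal (real CARD('a) powr real_of_int (- (2 * int k + 2))) \<le> c_alpha (A 0) f"
    by (rule c_alpha_ge[OF f_Theta]) (rule gain_le(1))
qed

text \<open>The future contributes \<open>2 * j + 2\<close>, which is \<open>2 * k\<close>, and the
  past contributes 1. The only larger value allowed by \<open>gain_le\<close> would make
  \<open>w\<close> a factor.\<close>

lemma c_alpha_perturbed_word:
  assumes w: "w = word t j @ [m]" "m \<noteq> c (t + int j)" and new: "\<And>s. word s k \<noteq> w"
  shows "c_alpha (A 0) f = ereal (real CARD('a) powr real_of_int (- (2 * int k + 1)))"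
proof (rule antisym)
  have k: "k = Suc j"
    by (simp add: w(1))
  have "ub (- (2 * int k + 1) + 1) (x n - 1 / A t)" if "n mod Suc k = 0" for n
  proof -
    have "dg (x n - 1 / A t) = - 2 * int j - 2"
      using cyl_diff_last[of 1 "word t j" m "x n" "c (t + int j)" "1 / A t"]
        cyl_block_start[OF that] cyl_word[of 1 t "Suc j"] w by (simp add: word_snoc)
    then show ?thesis
      by (simp add: ub_def k)
  qed
  then show "c_alpha (A 0) f \<le> ereal (real CARD('a) powr real_of_int (- (2 * int k + 1)))"
    by (intro c_alpha_le f_Theta gain_often)
  have "gain f b b' \<le> 2 * int k + 1" if "(b, b') \<in> TP" for b b'
    using gain_le[OF that] new by force
  then show "ereal (real CARD('a) powr real_of_int (- (2 * int k + 1))) \<le> c_alpha (A 0) f"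
    by (intro c_alpha_ge[OF f_Theta])
qed

lemma c_alpha_in_Sp: "c_alpha (A 0) f \<in> Sp (A 0)"
  unfolding Sp_def using f_irrational f_Theta by blast

end

section \<open>The gaps\<close>

context rich_line
begin

lemma block_approximation_exists:
  obtains f e a x where "block_approximation c p A l f e a x w"
proof -
  define a :: "nat \<Rightarrow> 'a fls" where
    "a n = (if n mod Suc (length w) = length w then fls_X_inv ^ 2 else letter (w ! (n mod Suc (length w))))" for n
  have a: "a n \<in> Rset" "1 \<le> dg (a n)" for n
    by (auto simp: a_def dg_power intro!: Rset_power)
  obtain x where x: "\<And>n. ub (-1) (x n)" "\<And>n. x n = 1 / (a n + x (Suc n))"
    using cf_exists[of a Suc] a by blast
  have "block_approximation c p A l (0 + x 0) 0 a x w"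
  proof unfold_locales
    show "x n = 1 / (a n + x (Suc n))" for n
      by (rule x(2))
    show "a n \<in> Rset" "1 \<le> dg (a n)" "ub (-1) (x n)" for n
      by (fact a x(1))+
  qed (simp_all add: a_def)
  then show ?thesis by (rule that)
qed

lemma even_in_Sp: "ereal (real CARD('a) powr real_of_int (- (2 * int k + 2))) \<in> Sp (A 0)"
proof -
  obtain f e a x where "block_approximation c p A l f e a x (word 0 k)"
    by (rule block_approximation_exists)
  then interpret block_approximation c p A l f e a x "word 0 k" .
  show ?thesis
    using c_alpha_in_Sp c_alpha_word[of 0] by simp
qed

text \<open>A run of \<open>l\<close> zeros occurs by \<open>rich\<close> and is followed by a
  nonzero letter by \<open>sparse\<close>. Replacing that letter by 0 yields a word ending in
  \<open>l + 1\<close> zeros, hence not a factor.\<close>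

lemma long_odd_in_Sp:
  assumes "l < k"
  shows "ereal (real CARD('a) powr real_of_int (- (2 * int k + 1))) \<in> Sp (A 0)"
proof -
  obtain t where t: "map (\<lambda>i. c (t + int i)) [0..<l] = replicate l 0"
    using rich[of "replicate l 0"] by auto
  have zero: "c (t + int i) = 0" if "i < l" for i
    using arg_cong[OF t, of "\<lambda>xs. xs ! i"] that by simp
  have nonzero: "c (t + int l) \<noteq> 0"
    using sparse[of t] zero le_neq_implies_less by blast
  define j where "j = k - 1"
  \<comment> \<open>With this start the \<open>j\<close> letters of the line end exactly with the
    run of zeros, and the nonzero letter sits at \<open>t0 + int j\<close>.\<close>
  define t0 where "t0 = t + int l - int j"
  define w where "w = word t0 j @ [0]"
  have k: "k = Suc j" "l \<le> j"
    using assms by (auto simp: j_def)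
  have new: "word s k \<noteq> w" for s
  proof
    assume s: "word s k = w"
    have "c (s + int (j - l) + int i) = 0" if i: "i \<le> l" for i
    proof -
      have "c (s + int (j - l) + int i) = w ! (j - l + i)"
        using i k by (simp add: algebra_simps of_nat_diff flip: s)
      also have "\<dots> = 0"
      proof (cases "i = l")
        case True
        then show ?thesis
          using k by (simp add: w_def nth_append)
      next
        case False
        then have "j - l + i < j"
          using i k by linarith
        then have "w ! (j - l + i) = c (t0 + int (j - l + i))"
          by (simp add: w_def nth_append)
        also have "t0 + int (j - l + i) = t + int i"
          using k by (simp add: t0_def of_nat_diff)
        finally show ?thesis
          using zero[of i] i False by simp
      qed
      finally show ?thesis .
    qed
    then show False
      using sparse[of "s + int (j - l)"] by blast
  qed
  obtain f e a x where "block_approximation c p A l f e a x w"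
    by (rule block_approximation_exists)
  then interpret block_approximation c p A l f e a x w .
  have lw: "length w = k"
    by (simp add: w_def k)
  have "c (t0 + int j) \<noteq> 0"
    using nonzero by (simp add: t0_def)
  then have "c_alpha (A 0) f = ereal (real CARD('a) powr real_of_int (- (2 * int k + 1)))"
    using c_alpha_perturbed_word[OF w_def] new unfolding lw by metis
  then show ?thesis
    using c_alpha_in_Sp by simp
qed

lemma rich_approximation_exists:
  assumes "f \<notin> Kset" "f \<notin> Theta (A 0)"
  obtains e a x where "rich_approximation c p A l f e a x"
proof -
  obtain e a x where "continued_fraction f e a x"
    using continued_fraction_exists[OF assms(1)] .
  then interpret continued_fraction f e a x .
  have "rich_approximation c p A l f e a x"
    by unfold_locales (rule assms(2))
  then show ?thesis by (rule that)
qed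

lemma Sp_le: 
  assumes "y \<in> Sp (A 0)"
  shows "y \<le> ereal (real CARD('a) powr real_of_int (- 2))"
proof -
  obtain f where f: "f \<notin> Kset" "f \<notin> Theta (A 0)" "y = c_alpha (A 0) f"
    using assms by (auto simp: Sp_def)
  obtain e a x where "rich_approximation c p A l f e a x"
    using rich_approximation_exists f(1,2) .
  then show ?thesis
    using rich_approximation.c_alpha_le_2 f(3) by blast
qed

lemma short_odd_notin_Sp:
  assumes "1 \<le> k" "k \<le> l"
  shows "ereal (real CARD('a) powr real_of_int (- (2 * int k + 1))) \<notin> Sp (A 0)"
proof
  assume "ereal (real CARD('a) powr real_of_int (- (2 * int k + 1))) \<in> Sp (A 0)"
  then obtain f where f: "f \<notin> Kset" "f \<notin> Theta (A 0)"
    "c_alpha (A 0) f = ereal (real CARD('a) powr real_of_int (- (2 * int k + 1)))"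
    unfolding Sp_def by (elim imageE) (metis DiffD2 UnCI)
  obtain e a x where "rich_approximation c p A l f e a x"
    using rich_approximation_exists f(1,2) .
  then show False
    using rich_approximation.c_alpha_neq_short_odd assms f(3) by blast
qed

lemma Hw_eq: "Hw (A 0) = ereal (real CARD('a) powr real_of_int (- 2))"
  unfolding Hw_def using even_in_Sp[of 0] by (intro antisym Sup_least Sup_upper Sp_le) auto

lemma missing_eq: "missing (A 0) = (\<lambda>k. 2 * int k + 1) ` {1..l}"
proof (intro equalityI subsetI)
  fix n
  assume "n \<in> missing (A 0)"
  then have "ereal (real CARD('a) powr real_of_int (- n)) < ereal (real CARD('a) powr real_of_int (- 2))"
    and notin: "ereal (real CARD('a) powr real_of_int (- n)) \<notin> Sp (A 0)"
    by (simp_all add: missing_def Hw_eq)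
  then have n: "2 < n"
    unfolding less_ereal.simps qpow_less by simp
  define k where "k = nat (n div 2)"
  show "n \<in> (\<lambda>k. 2 * int k + 1) ` {1..l}"
  proof (cases "even n")
    case True
    then have "n = 2 * int (k - 1) + 2"
      using n by (auto simp: k_def elim!: evenE)
    then show ?thesis
      using even_in_Sp[of "k - 1"] notin by simp
  next
    case False
    then have "n = 2 * int k + 1" "1 \<le> k"
      using n by (auto simp: k_def elim!: oddE)
    then show ?thesis
      using long_odd_in_Sp[of k] notin by (cases "k \<le> l") auto
  qed
next
  fix n
  assume "n \<in> (\<lambda>k. 2 * int k + 1) ` {1..l}"
  then obtain k where k: "1 \<le> k" "k \<le> l" "n = 2 * int k + 1"
    by auto
  have "ereal (real CARD('a) powr real_of_int (- n)) < ereal (real CARD('a) powr real_of_int (- 2))"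
    unfolding less_ereal.simps qpow_less using k by simp
  then show "n \<in> missing (A 0)"
    using short_odd_notin_Sp[OF k(1,2)] unfolding missing_def Hw_eq k(3) by simp
qed

text \<open>All missing exponents are odd, so no two of them are adjacent and every gap is a
  singleton.\<close>

lemma gaps_eq: "gaps (A 0) = (\<lambda>k. {2 * int k + 1}) ` {1..l}"
proof -
  have single: "G = {n}" if G: "G \<subseteq> missing (A 0)" "consecutive G" "n \<in> G" for G n
  proof -
    have odd: "odd m" if "m \<in> G" for m
      using that G(1) by (auto simp: missing_eq)
    have "\<not> m < m'" if "m \<in> G" "m' \<in> G" for m m'
    proof
      assume "m < m'"
      then have "m + 1 \<in> {m..m'}" by simp
      then have "m + 1 \<in> G"
        using G(2) that unfolding consecutive_def by blast
      then show False
        using odd[of m] odd[of "m + 1"] that by simp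
    qed
    then have "m = n" if "m \<in> G" for m
      using that G(3) by (meson linorder_less_linear)
    then show ?thesis
      using G(3) by blast
  qed
  have "gaps (A 0) = (\<lambda>n. {n}) ` missing (A 0)"
  proof (intro equalityI subsetI)
    fix G
    assume "G \<in> gaps (A 0)"
    then have G: "G \<noteq> {}" "G \<subseteq> missing (A 0)" "consecutive G"
      by (auto simp: gaps_def)
    then obtain n where "n \<in> G" by blast
    then show "G \<in> (\<lambda>n. {n}) ` missing (A 0)"
      using single[OF G(2,3)] G(2) by blast
  next
    fix G
    assume "G \<in> (\<lambda>n. {n}) ` missing (A 0)"
    then obtain n where n: "n \<in> missing (A 0)" "G = {n}" by blast
    then show "G \<in> gaps (A 0)"
      unfolding gaps_def using single by (auto simp: consecutive_def)
  qed
  then show ?thesis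
    by (simp add: missing_eq image_image)
qed

lemma card_gaps: "finite (gaps (A 0))" "card (gaps (A 0)) = l"
  unfolding gaps_eq by (auto simp: card_image inj_on_def)

end

section \<open>Construction of the period\<close>

text \<open>The period is \<open>W0 @ 1 # rev W0\<close>, where \<open>W0\<close> concatenates the blocks \<open>1 # u @ 1 # v\<close> over all words
  \<open>u\<close>, \<open>v\<close> of length \<open>l\<close>; all its positions divisible by \<open>l + 1\<close> carry a \<open>1\<close>.\<close>

lemma palindromic_rich_sequence:
  fixes l :: nat
  assumes l: "l > 0"
  shows "\<exists>(c :: int \<Rightarrow> 'a::{field,finite}) p. p > 0 \<and> (\<forall>t. c (t + int p) = c t) \<and> (\<forall>t. c (- 1 - t) = c t) \<and>
    (\<forall>t. \<exists>i\<le>l. c (t + int i) \<noteq> 0) \<and>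
    (\<forall>v. length v \<le> l \<longrightarrow> (\<exists>t t'. map (\<lambda>i. c (t + int i)) [0..<length v] = v \<and>
      map (\<lambda>i. c (t' + int i)) [0..<length v] = v \<and> c (t - 1) = c (t' - 1) \<and> c (t - 2) \<noteq> c (t' - 2)))"
proof -
  define L where "L = {v :: 'a list. length v = l}"
  have "finite L"
    using finite_lists_length_eq[of "UNIV :: 'a set" l] by (simp add: L_def)
  then obtain ps where ps: "set ps = L \<times> L"
    using finite_list[of "L \<times> L"] by auto
  define blk :: "'a list \<times> 'a list \<Rightarrow> 'a list" where "blk = (\<lambda>(u, v). 1 # u @ 1 # v)"
  define W0 where "W0 = concat (map blk ps)"
  define W where "W = W0 @ 1 # rev W0"
  define p where "p = length W"
  define c where "c s = W ! nat (s mod int p)" for s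
  have p: "p = 2 * length W0 + 1" "p > 0"
    by (simp_all add: p_def W_def)
  have c_nth: "c (int i) = W ! i" if "i < p" for i
    using that by (simp add: c_def)
  have ones: "Suc l dvd length W0 \<and> (\<forall>i<length W0. Suc l dvd i \<longrightarrow> W0 ! i = 1)"
  proof -
    have "set qs \<subseteq> L \<times> L \<Longrightarrow> Suc l dvd length (concat (map blk qs)) \<and>
        (\<forall>i<length (concat (map blk qs)). Suc l dvd i \<longrightarrow> concat (map blk qs) ! i = 1)" for qs
    proof (induction qs)
      case (Cons q qs)
      obtain u v where q: "q = (u, v)" "length u = l" "length v = l"
        using Cons.prems by (cases q) (auto simp: L_def)
      define R where "R = concat (map blk qs)"
      have R: "Suc l dvd length R" "\<And>i. i < length R \<Longrightarrow> Suc l dvd i \<Longrightarrow> R ! i = 1"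
        using Cons by (auto simp: R_def)
      have len: "length (blk q) = Suc l * 2"
        using q by (simp add: blk_def)
      have "(blk q @ R) ! i = 1" if i: "i < length (blk q @ R)" "Suc l dvd i" for i
      proof (cases "i < Suc l * 2")
        case True
        obtain d where d: "i = Suc l * d"
          using i(2) by (rule dvdE)
        then have "d < 2"
          using True by (metis mult_less_cancel1)
        then have "d = 0 \<or> d = 1" by linarith
        then have "i = 0 \<or> i = Suc l"
          using d by auto
        then show ?thesis
          using q by (auto simp: blk_def nth_append)
      next
        case False
        then have "Suc l dvd (i - Suc l * 2)"
          using i(2) by (intro dvd_diff_nat dvd_triv_left)
        then show ?thesis
          using R(2)[of "i - Suc l * 2"] False i(1) len by (simp add: nth_append)
      qed
      moreover have "Suc l dvd length (blk q @ R)"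
        unfolding length_append len using R(1) by (intro dvd_add dvd_triv_left)
      ultimately show ?case
        by (simp add: R_def)
    qed simp
    from this[of ps] show ?thesis
      by (simp add: W0_def ps)
  qed
  have W1: "W ! i = 1" if "i < p" "Suc l dvd i" for i
  proof (cases "i < length W0")
    case True
    then show ?thesis
      using ones that by (simp add: W_def nth_append)
  next
    case False
    show ?thesis
    proof (cases "i = length W0")
      case True
      then show ?thesis by (simp add: W_def nth_append)
    next
      case neq: False
      \<comment> \<open>The mirror image of position \<open>i\<close>; it remains divisible by
        \<open>Suc l\<close> because \<open>length W0\<close> is.\<close>
      define j where "j = 2 * length W0 - i"
      have j: "j < length W0" "i - length W0 = Suc (length W0 - Suc j)"
        using False neq that p by (auto simp: j_def)
      have "Suc l dvd j"
        unfolding j_def using ones that by (intro dvd_diff_nat) auto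
      then have "W0 ! j = 1"
        using ones j by blast
      then show ?thesis
        using False j by (simp add: W_def nth_append rev_nth)
    qed
  qed
  have sparse: "\<exists>i\<le>l. c (t + int i) \<noteq> 0" for t
  proof -
    define r where "r = nat (t mod int p)"
    have r: "r < p" "int r = t mod int p"
      using p by (auto simp: r_def nat_less_iff)
    \<comment> \<open>The least multiple of \<open>Suc l\<close> that is at least \<open>r\<close>.
      It stays inside the period, since the last position \<open>2 * length W0\<close> is itself a
      multiple.\<close>
    define m where "m = (r + l) div Suc l * Suc l"
    have m: "m \<le> r + l" "r \<le> m"
    proof -
      show "m \<le> r + l"
        by (simp add: m_def del: mult_Suc_right)
      have "r + l = m + (r + l) mod Suc l" "(r + l) mod Suc l < Suc l"
        unfolding m_def by (simp_all del: mult_Suc_right)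
      then show "r \<le> m" by linarith
    qed
    have "m < p"
    proof (rule ccontr)
      assume "\<not> m < p"
      moreover have "Suc l dvd 2 * length W0" "Suc l dvd m"
        unfolding m_def using ones by (auto intro: dvd_triv_right simp del: mult_Suc_right)
      ultimately have "Suc l dvd m - 2 * length W0" "0 < m - 2 * length W0"
        using p(1) by (auto intro: dvd_diff_nat)
      then have "Suc l \<le> m - 2 * length W0"
        by (rule dvd_imp_le)
      then show False
        using m r(1) p(1) by linarith
    qed
    moreover have "Suc l dvd m"
      by (simp add: m_def del: mult_Suc_right)
    ultimately have "W ! m = 1"
      by (rule W1)
    moreover have "(t + int (m - r)) mod int p = int m"
    proof -
      have "(t + int (m - r)) mod int p = (int r + int (m - r)) mod int p"
        unfolding r(2) by (simp add: mod_add_left_eq)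
      then show ?thesis
        using m(2) \<open>m < p\<close> by (simp add: of_nat_diff)
    qed
    ultimately have "c (t + int (m - r)) = 1"
      by (simp add: c_def)
    then show ?thesis
      using m by (intro exI[of _ "m - r"]) auto
  qed
  have palin: "c (- 1 - t) = c t" for t
  proof -
    define r where "r = nat (t mod int p)"
    have r: "r < p" "int r = t mod int p"
      using p by (auto simp: r_def nat_less_iff)
    have "(- 1 - t) mod int p = (- 1 - int r) mod int p"
      unfolding r(2) by (simp add: mod_diff_right_eq)
    also have "\<dots> = (int p - 1 - int r) mod int p"
      by (metis (no_types, opaque_lifting) add_diff_eq diff_add_eq mod_add_self1 add.commute diff_conv_add_uminus minus_diff_eq uminus_add_conv_diff)
    also have "\<dots> = int (p - 1 - r)"
      using r(1) by (simp add: of_nat_diff)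
    finally have "c (- 1 - t) = W ! (p - 1 - r)"
      by (simp add: c_def)
    also have "\<dots> = rev W ! r"
      using r(1) by (simp add: rev_nth p_def)
    also have "rev W = W"
      by (simp add: W_def)
    finally show ?thesis
      by (simp add: c_def r_def)
  qed
  have occ: "\<exists>t. map (\<lambda>i. c (t + int i)) [0..<length v] = v \<and> c (t - 1) = 1 \<and> c (t - 2) = y"
    if v: "length v \<le> l" for v y
  proof -
    \<comment> \<open>Padding to length \<open>l\<close> makes \<open>v'\<close> eligible as a
      second word of a block; the constant first word \<open>u\<close> puts \<open>y\<close>
      directly before the inner 1.\<close>
    define v' where "v' = v @ replicate (l - length v) 0"
    define u where "u = replicate l y"
    have "(u, v') \<in> set ps"
      using v by (simp add: ps L_def u_def v'_def)
    then obtain qs qs' where "ps = qs @ (u, v') # qs'"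
      using split_list by fastforce
    then obtain X Z where W: "W = X @ 1 # u @ 1 # v @ Z"
      by (simp add: W_def W0_def blk_def v'_def)
    \<comment> \<open>Skips \<open>X\<close>, the leading 1, the \<open>l\<close> letters of
      \<open>u\<close> and the inner 1.\<close>
    define t where "t = length X + l + 2"
    have t: "t + length v \<le> p"
      by (simp add: p_def W t_def u_def)
    have "c (int t + int i) = v ! i" if "i < length v" for i
    proof -
      have "c (int t + int i) = W ! (t + i)"
        using c_nth[of "t + i"] t that by simp
      also have "\<dots> = v ! i"
        using that unfolding W by (simp add: t_def u_def nth_append)
      finally show ?thesis .
    qed
    then have "map (\<lambda>i. c (int t + int i)) [0..<length v] = v"
      by (intro nth_equalityI) auto
    moreover have "c (int t - 1) = 1"
    proof -
      have "c (int t - 1) = W ! (t - 1)"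
        using c_nth[of "t - 1"] t by (simp add: t_def)
      also have "\<dots> = 1"
        unfolding W by (simp add: t_def u_def nth_append)
      finally show ?thesis .
    qed
    moreover have "c (int t - 2) = y"
    proof -
      have "c (int t - 2) = W ! (t - 2)"
        using c_nth[of "t - 2"] t by (simp add: t_def)
      also have "\<dots> = y"
        using l unfolding W by (simp add: t_def u_def nth_append nth_Cons')
      finally show ?thesis .
    qed
    ultimately show ?thesis by blast
  qed
  have "c (t + int p) = c t" for t
    by (simp add: c_def)
  moreover have "\<exists>t t'. map (\<lambda>i. c (t + int i)) [0..<length v] = v \<and>
      map (\<lambda>i. c (t' + int i)) [0..<length v] = v \<and> c (t - 1) = c (t' - 1) \<and> c (t - 2) \<noteq> c (t' - 2)"
    if "length v \<le> l" for v
    using occ[OF that, of 0] occ[OF that, of 1] by (metis zero_neq_one)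
  ultimately show ?thesis
    using p(2) palin sparse by blast
qed

theorem theorem1p5:
  fixes l :: nat
  assumes "l > 0"
  shows "\<exists>\<alpha> :: 'a::{field,finite} fls. \<alpha> \<in> K2 \<and> finite (gaps \<alpha>) \<and> card (gaps \<alpha>) = l"
proof -
  obtain c :: "int \<Rightarrow> 'a" and p where c: "p > 0" "\<And>t. c (t + int p) = c t" "\<And>t. c (- 1 - t) = c t"
    "\<And>t. \<exists>i\<le>l. c (t + int i) \<noteq> 0"
    "\<And>v. length v \<le> l \<Longrightarrow> (\<exists>t t'. map (\<lambda>i. c (t + int i)) [0..<length v] = v \<and>
      map (\<lambda>i. c (t' + int i)) [0..<length v] = v \<and> c (t - 1) = c (t' - 1) \<and> c (t - 2) \<noteq> c (t' - 2))"
    using palindromic_rich_sequence[OF assms] by blast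
  obtain x where x: "\<And>t. ub (-1) (x t)" "\<And>t. x t = 1 / (letter (c t) + x (t + 1))"
  proof -
    have "\<exists>x. \<forall>t. ub (-1) (x t) \<and> x t = 1 / (letter (c t) + x (t + 1))"
      by (rule cf_exists) simp
    then show ?thesis
      using that by blast
  qed
  define A where "A t = 1 / x t" for t
  interpret rich_line c p A l
  proof unfold_locales
    show "A t = letter (c t) + 1 / A (t + 1)" for t
      unfolding A_def by (subst x(2)) simp
    show "ub (-1) (1 / A t)" for t
      using x(1) by (simp add: A_def)
  qed (use assms c in blast)+
  show ?thesis
    using A_K2 card_gaps by blast
qed

end
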